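(* The functor $\mathrm{CE}\colon\mathbf{Csys}\to\mathbf{rCEsys}_s$, from the category of C-systems to the category of stratified rooted CE-systems and stratified CE-homomorphisms, described in the context, is an equivalence of categories.
   Context: **Strict categories, stratification.** A strict category is a (small) category regarded as an algebraic structure, so that equality of objects is meaningful. Let $\mathcal C$ be a strict category with a chosen terminal object $1$. A stratification of $\mathcal C$ is a functor $L\colon\mathcal C\to(\mathbb N,\ge)$ such that (1) $L(X)=0$ iff $X=1$; (2) for any $f\colon X\to Y$, $L(X)=L(Y)$ iff $X=Y$ and $f=\mathrm{id}_X$; (3) every $f\colon X\to Y$ with $L(X)=n+m+1$, $L(Y)=n$ has a unique factorization $X=X_{m+1}\to X_m\to\cdots\to X_1\to X_0=Y$ with $L(X_i)=n+i$. Stratifications are unique when they exist. A functor $F$ between stratified categories is stratified if $L_{\mathcal C}=L_{\mathcal D}\circ F$. Slices $\mathcal C/X$ of a stratified category (chosen terminal object $\mathrm{id}_X$) are stratified by $L_X(f\colon Y\to X)=L(Y)-L(X)$. **Slice notation.** For a strict category $\mathcal F$ and object $\Gamma$, $A\in\mathcal F/\Gamma$ means $A$ is an object of the slice, i.e. an arrow $A\colon\Gamma.A\to\Gamma$. For $P\in\mathcal F/\Gamma.A$, $A.P:=A\circ P\in\mathcal F/\Gamma$. **C-systems.** A C-system consists of a strict category $\mathcal C$, a function $\ell\colon\mathrm{Ob}(\mathcal C)\to\mathbb N$, a chosen object $1$, a function $\mathsf{ft}\colon\mathrm{Ob}(\mathcal C)\to\mathrm{Ob}(\mathcal C)$, for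 each $\Gamma$ with $\ell(\Gamma)>0$ a morphism $\mathsf p_\Gamma\colon\Gamma\to\mathsf{ft}(\Gamma)$, and for each such $\Gamma$ and each $f\colon\Delta\to\mathsf{ft}(\Gamma)$ an object $f^*\Gamma$ and a morphism $\mathsf q(f,\Gamma)\colon f^*\Gamma\to\Gamma$, such that: $\ell^{-1}(0)=\{1\}$; $\ell(\mathsf{ft}(\Gamma))=\ell(\Gamma)-1$ if $\ell(\Gamma)>0$; $\mathsf{ft}(1)=1$; $1$ is terminal; for $\ell(\Gamma)>0$ and $f\colon\Delta\to\mathsf{ft}(\Gamma)$: $\ell(f^*\Gamma)>0$, $\mathsf{ft}(f^*\Gamma)=\Delta$, and the square $\mathsf p_\Gamma\circ\mathsf q(f,\Gamma)=f\circ\mathsf p_{f^*\Gamma}$ commutes and is a pullback; $(\mathrm{id}_{\mathsf{ft}(\Gamma)})^*\Gamma=\Gamma$ and $\mathsf q(\mathrm{id}_{\mathsf{ft}(\Gamma)},\Gamma)=\mathrm{id}_\Gamma$; for $g\colon\Delta\to\mathsf{ft}(\Gamma)$, $f\colon E\to\Delta$: $(g\circ f)^*\Gamma=f^*g^*\Gamma$ and $\mathsf q(g\circ f,\Gamma)=\mathsf q(g,\Gamma)\circ\mathsf q(f,g^*\Gamma)$. A morphism of C-systems is a functor strictly preserving $1,\ell,\mathsf{ft},\mathsf p$, and $f^*\Gamma$, $\mathsf q(f,\Gamma)$. $\mathbf{Csys}$ is the resulting category. **CE-systems.** A CE-system consists of two strict categories $\mathcal F,\mathcal C$ with the same objects,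 an identity-on-objects functor $I\colon\mathcal F\to\mathcal C$, a chosen object $1$ terminal in $\mathcal F$, and, for every $f\colon\Delta\to\Gamma$ in $\mathcal C$ and $A\in\mathcal F/\Gamma$, a choice of $f^*A\in\mathcal F/\Delta$ and of an arrow $\pi_2(f,A)\colon\Delta.f^*A\to\Gamma.A$ in $\mathcal C$ such that $I(A)\circ\pi_2(f,A)=f\circ I(f^*A)$ is a pullback square in $\mathcal C$, functorially: (a) $f^*\mathrm{id}_\Gamma=\mathrm{id}_\Delta$, $\pi_2(f,\mathrm{id}_\Gamma)=f$; (b) $\mathrm{id}_\Gamma^*A=A$, $\pi_2(\mathrm{id}_\Gamma,A)=\mathrm{id}_{\Gamma.A}$; (c) $(f\circ g)^*A=g^*(f^*A)$, $\pi_2(f\circ g,A)=\pi_2(f,A)\circ\pi_2(g,f^*A)$; (d) for $P\in\mathcal F/\Gamma.A$, $f^*(A.P)=f^*A\circ\pi_2(f,A)^*P$, $\pi_2(f,A.P)=\pi_2(\pi_2(f,A),P)$. Each $f$ induces a functor $f^*\colon\mathcal F/\Gamma\to\mathcal F/\Delta$. The CE-system is rooted if $1$ is terminal in $\mathcal C$; it is stratified if $\mathcal F$ is stratified and each $f^*\colon\mathcal F/\Gamma\to\mathcal F/\Delta$ is stratified. A CE-homomorphism is a pair of functors $(F_{\mathcal F},F_{\mathcal C})$ commuting with the functors $I$, with $F_{\mathcal F}(1)=1$, $F_{\mathcal F}(f^*A)=(F_{\mathcal C}f)^*(F_{\mathcal F}A)$ and $F_{\mathcal C}(\pi_2(f,A))=\pi_2(F_{\mathcal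 C}f,F_{\mathcal F}A)$; it is stratified if $F_{\mathcal F}$ is. $\mathbf{rCEsys}_s$ is the category of stratified rooted CE-systems and stratified CE-homomorphisms. **The functor $\mathrm{CE}$.** For a C-system with underlying category $\mathcal C$, let $\mathcal F$ be the free category on the graph with vertices the objects of $\mathcal C$ and edges $\mathsf p_\Gamma\colon\Gamma\to\mathsf{ft}(\Gamma)$ ($\ell(\Gamma)>0$), let $I\colon\mathcal F\to\mathcal C$ be the identity-on-objects functor sending a path to its composite, the chosen terminal object is $1$, and the chosen pullbacks along $f\colon\Delta\to\Gamma$ are defined by induction on the length of a path: $f^*\mathrm{id}_\Gamma=\mathrm{id}_\Delta$, $\pi_2(f,\mathrm{id}_\Gamma)=f$; for $p=p'\circ\mathsf p_\Xi$ with $p'\colon\mathsf{ft}(\Xi)\to\Gamma$ and $g=\pi_2(f,p')$, $f^*p=f^*p'\circ\mathsf p_{g^*\Xi}$ and $\pi_2(f,p)=\mathsf q(g,\Xi)$. This is a stratified rooted CE-system. A morphism of C-systems $F$ is sent to $(F_{\mathcal F},F)$ with $F_{\mathcal F}$ the functor between free categories determined by $\mathsf p_\Gamma\mapsto\mathsf p_{F\Gamma}$. *)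

theory Defs
  imports Main "HOL-Library.FuncSet"
begin

section \<open>Strict categories\<close>

text \<open>
  A strict (small) category has a set of objects in a type \<open>'o\<close> and a set of arrows in a
  type \<open>'a\<close>; both types are arbitrary and play the role of the universe. Composition is
  written in the usual order: \<open>Comp C g f\<close> is \<open>g \<circ> f\<close>. As in HOL-Algebra, the values of
  the operations outside the carriers are irrelevant; structure-preserving maps, on the
  other hand, are made extensional, so that parallel morphisms are equal iff they agree on
  the carriers.
\<close>

record ('o, 'a) graph =
  Obj :: "'o set"
  Arr :: "'a set"
  Dom :: "'a \<Rightarrow> 'o"
  Cod :: "'a \<Rightarrow> 'o"

record ('o, 'a) cat = "('o, 'a) graph" +
  Idt :: "'o \<Rightarrow> 'a"
  Comp :: "'a \<Rightarrow> 'a \<Rightarrow> 'a"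

definition Hom :: "('o, 'a, 'm) graph_scheme \<Rightarrow> 'o \<Rightarrow> 'o \<Rightarrow> 'a set" where
  "Hom C X Y = {f \<in> Arr C. Dom C f = X \<and> Cod C f = Y}"

locale category =
  fixes C :: "('o, 'a) cat"
  assumes Dom_in: "f \<in> Arr C \<Longrightarrow> Dom C f \<in> Obj C"
    and Cod_in: "f \<in> Arr C \<Longrightarrow> Cod C f \<in> Obj C"
    and Idt_in: "X \<in> Obj C \<Longrightarrow> Idt C X \<in> Hom C X X"
    and Comp_in: "f \<in> Hom C X Y \<Longrightarrow> g \<in> Hom C Y Z \<Longrightarrow> Comp C g f \<in> Hom C X Z"
    and Comp_Idt: "f \<in> Hom C X Y \<Longrightarrow> Comp C f (Idt C X) = f"
    and Idt_Comp: "f \<in> Hom C X Y \<Longrightarrow> Comp C (Idt C Y) f = f"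
    and Comp_assoc: "f \<in> Hom C W X \<Longrightarrow> g \<in> Hom C X Y \<Longrightarrow> h \<in> Hom C Y Z \<Longrightarrow>
        Comp C h (Comp C g f) = Comp C (Comp C h g) f"

definition terminal :: "('o, 'a) cat \<Rightarrow> 'o \<Rightarrow> bool" where
  "terminal C t \<longleftrightarrow> t \<in> Obj C \<and> (\<forall>X\<in>Obj C. \<exists>!f. f \<in> Hom C X t)"

text \<open>\<open>pullback C f g p q\<close>: the square \<open>f \<circ> p = g \<circ> q\<close> is a pullback of the cospan \<open>(f, g)\<close>.\<close>

definition pullback :: "('o, 'a) cat \<Rightarrow> 'a \<Rightarrow> 'a \<Rightarrow> 'a \<Rightarrow> 'a \<Rightarrow> bool" where
  "pullback C f g p q \<longleftrightarrow>
     f \<in> Arr C \<and> g \<in> Arr C \<and> p \<in> Arr C \<and> q \<in> Arr C \<and>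
     Cod C f = Cod C g \<and> Dom C p = Dom C q \<and> Cod C p = Dom C f \<and> Cod C q = Dom C g \<and>
     Comp C f p = Comp C g q \<and>
     (\<forall>W\<in>Obj C. \<forall>u\<in>Hom C W (Dom C f). \<forall>v\<in>Hom C W (Dom C g).
        Comp C f u = Comp C g v \<longrightarrow>
        (\<exists>!h. h \<in> Hom C W (Dom C p) \<and> Comp C p h = u \<and> Comp C q h = v))"

definition iso_arr :: "('o, 'a) cat \<Rightarrow> 'a \<Rightarrow> bool" where
  "iso_arr C f \<longleftrightarrow> f \<in> Arr C \<and>
     (\<exists>g \<in> Hom C (Cod C f) (Dom C f).
        Comp C g f = Idt C (Dom C f) \<and> Comp C f g = Idt C (Cod C f))"


section \<open>Functors and equivalences\<close>

record ('o, 'a, 'o2, 'a2) ftr =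
  OMap :: "'o \<Rightarrow> 'o2"
  AMap :: "'a \<Rightarrow> 'a2"

locale is_functor = src: category C + tgt: category D
  for C :: "('o, 'a) cat" and D :: "('o2, 'a2) cat" +
  fixes F :: "('o, 'a, 'o2, 'a2) ftr"
  assumes OMap_in: "X \<in> Obj C \<Longrightarrow> OMap F X \<in> Obj D"
    and AMap_in: "f \<in> Hom C X Y \<Longrightarrow> AMap F f \<in> Hom D (OMap F X) (OMap F Y)"
    and AMap_Idt: "X \<in> Obj C \<Longrightarrow> AMap F (Idt C X) = Idt D (OMap F X)"
    and AMap_Comp: "f \<in> Hom C X Y \<Longrightarrow> g \<in> Hom C Y Z \<Longrightarrow>
        AMap F (Comp C g f) = Comp D (AMap F g) (AMap F f)"

definition id_ftr :: "('o, 'a, 'o, 'a) ftr" where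
  "id_ftr = \<lparr>OMap = (\<lambda>X. X), AMap = (\<lambda>f. f)\<rparr>"

definition comp_ftr ::
    "('o2, 'a2, 'o3, 'a3) ftr \<Rightarrow> ('o1, 'a1, 'o2, 'a2) ftr \<Rightarrow> ('o1, 'a1, 'o3, 'a3) ftr" where
  "comp_ftr G F = \<lparr>OMap = (\<lambda>X. OMap G (OMap F X)), AMap = (\<lambda>f. AMap G (AMap F f))\<rparr>"

definition restrict_ftr :: "('o, 'a) cat \<Rightarrow> ('o, 'a, 'o2, 'a2) ftr \<Rightarrow> ('o, 'a, 'o2, 'a2) ftr" where
  "restrict_ftr C F = \<lparr>OMap = restrict (OMap F) (Obj C), AMap = restrict (AMap F) (Arr C)\<rparr>"

definition extensional_ftr :: "('o, 'a) cat \<Rightarrow> ('o, 'a, 'o2, 'a2) ftr \<Rightarrow> bool" where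
  "extensional_ftr C F \<longleftrightarrow> OMap F \<in> extensional (Obj C) \<and> AMap F \<in> extensional (Arr C)"

locale natural_iso = dom: is_functor C D F + cod: is_functor C D G
  for C :: "('o, 'a) cat" and D :: "('o2, 'a2) cat" and F G :: "('o, 'a, 'o2, 'a2) ftr" +
  fixes \<eta> :: "'o \<Rightarrow> 'a2"
  assumes component: "X \<in> Obj C \<Longrightarrow> \<eta> X \<in> Hom D (OMap F X) (OMap G X)"
    and natural: "f \<in> Hom C X Y \<Longrightarrow> Comp D (\<eta> Y) (AMap F f) = Comp D (AMap G f) (\<eta> X)"
    and iso: "X \<in> Obj C \<Longrightarrow> iso_arr D (\<eta> X)"

definition equivalence_of_categories ::
    "('o, 'a) cat \<Rightarrow> ('o2, 'a2) cat \<Rightarrow> ('o, 'a, 'o2, 'a2) ftr \<Rightarrow> bool" where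
  "equivalence_of_categories C D F \<longleftrightarrow>
     is_functor C D F \<and>
     (\<exists>G. is_functor D C G \<and>
        (\<exists>\<eta>. natural_iso C C id_ftr (comp_ftr G F) \<eta>) \<and>
        (\<exists>\<epsilon>. natural_iso D D (comp_ftr F G) id_ftr \<epsilon>))"


section \<open>Paths and free categories\<close>

text \<open>Paths are lists of consecutive edges in the order in which they are traversed.\<close>

fun path :: "('o, 'a, 'm) graph_scheme \<Rightarrow> 'o \<Rightarrow> 'a list \<Rightarrow> 'o \<Rightarrow> bool" where
  "path C X [] Y \<longleftrightarrow> X \<in> Obj C \<and> X = Y"
| "path C X (f # fs) Y \<longleftrightarrow> X \<in> Obj C \<and> f \<in> Arr C \<and> Dom C f = X \<and> path C (Cod C f) fs Y"

primrec composite :: "('o, 'a) cat \<Rightarrow> 'o \<Rightarrow> 'a list \<Rightarrow> 'a" where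
  "composite C X [] = Idt C X"
| "composite C X (f # fs) = Comp C (composite C (Cod C f) fs) f"

text \<open>
  The free category on a graph. A path is the triple of its source, its list of edges and
  its target. The free category being defined only up to isomorphism, its arrows may be
  any names for the paths; these are supplied by an injection \<open>enc\<close> (for instance the
  identity) into the type of arrows.
\<close>

definition paths :: "('v, 'e) graph \<Rightarrow> ('v \<times> 'e list \<times> 'v) set" where
  "paths G = {(X, es, Y). path G X es Y}"

definition free_category ::
    "('v \<times> 'e list \<times> 'v \<Rightarrow> 'f) \<Rightarrow> ('v, 'e) graph \<Rightarrow> ('v, 'f) cat" where
  "free_category enc G =
     \<lparr>Obj = Obj G,
      Arr = enc ` paths G,
      Dom = (\<lambda>a. case inv enc a of (X, es, Y) \<Rightarrow> X),
      Cod = (\<lambda>a. case inv enc a of (X, es, Y) \<Rightarrow> Y),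
      Idt = (\<lambda>X. enc (X, [], X)),
      Comp = (\<lambda>b a. case inv enc a of (X, es, Y) \<Rightarrow>
                case inv enc b of (Y', es', Z) \<Rightarrow> enc (X, es @ es', Z))\<rparr>"


section \<open>Stratifications\<close>

text \<open>
  In the factorization axiom the list \<open>gs\<close> consists of the arrows
  \<open>X\<^sub>m\<^sub>+\<^sub>1 \<rightarrow> X\<^sub>m, \<dots>, X\<^sub>1 \<rightarrow> X\<^sub>0\<close> in this order, so \<open>gs ! (m - i)\<close> is the arrow
  \<open>X\<^sub>i\<^sub>+\<^sub>1 \<rightarrow> X\<^sub>i\<close>.
\<close>

locale stratification = category C
  for C :: "('o, 'a) cat" +
  fixes t :: 'o and L :: "'o \<Rightarrow> nat"
  assumes terminal: "terminal C t"
    and mono: "f \<in> Hom C X Y \<Longrightarrow> L X \<ge> L Y"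
    and zero_iff: "X \<in> Obj C \<Longrightarrow> L X = 0 \<longleftrightarrow> X = t"
    and eq_iff: "f \<in> Hom C X Y \<Longrightarrow> L X = L Y \<longleftrightarrow> X = Y \<and> f = Idt C X"
    and factorization: "f \<in> Hom C X Y \<Longrightarrow> L X = n + m + 1 \<Longrightarrow> L Y = n \<Longrightarrow>
        \<exists>!gs. length gs = m + 1 \<and> path C X gs Y \<and> composite C X gs = f \<and>
              (\<forall>i\<le>m. L (Cod C (gs ! (m - i))) = n + i)"

definition slice :: "('o, 'a) cat \<Rightarrow> 'o \<Rightarrow> 'a set" where
  "slice C X = {A \<in> Arr C. Cod C A = X}"

text \<open>The stratification of the slices induced by a stratification \<open>L\<close>.\<close>

definition slice_level :: "('o, 'a) cat \<Rightarrow> ('o \<Rightarrow> nat) \<Rightarrow> 'a \<Rightarrow> nat" where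
  "slice_level C L A = L (Dom C A) - L (Cod C A)"

text \<open>
  A functor between stratified categories (with chosen terminal objects \<open>t\<close> and \<open>u\<close>) that
  preserves the stratifications. As stratifications are unique on objects, it does not matter
  that they are quantified existentially.
\<close>

definition stratified_functor ::
    "('o, 'a) cat \<Rightarrow> 'o \<Rightarrow> ('o2, 'a2) cat \<Rightarrow> 'o2 \<Rightarrow> ('o, 'a, 'o2, 'a2) ftr \<Rightarrow> bool" where
  "stratified_functor C t D u F \<longleftrightarrow> is_functor C D F \<and>
     (\<exists>L M. stratification C t L \<and> stratification D u M \<and>
        (\<forall>X\<in>Obj C. L X = M (OMap F X)))"


section \<open>C-systems\<close>

record ('o, 'a) csys =
  cs_cat :: "('o, 'a) cat"
  cs_len :: "'o \<Rightarrow> nat"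
  cs_one :: 'o
  cs_ft :: "'o \<Rightarrow> 'o"
  cs_p :: "'o \<Rightarrow> 'a"
  cs_pb :: "'a \<Rightarrow> 'o \<Rightarrow> 'o"
  cs_q :: "'a \<Rightarrow> 'o \<Rightarrow> 'a"

locale c_system = category "cs_cat S"
  for S :: "('o, 'a) csys" +
  assumes one_in: "cs_one S \<in> Obj (cs_cat S)"
    and ft_in: "\<Gamma> \<in> Obj (cs_cat S) \<Longrightarrow> cs_ft S \<Gamma> \<in> Obj (cs_cat S)"
    and p_in: "\<Gamma> \<in> Obj (cs_cat S) \<Longrightarrow> cs_len S \<Gamma> > 0 \<Longrightarrow>
        cs_p S \<Gamma> \<in> Hom (cs_cat S) \<Gamma> (cs_ft S \<Gamma>)"
    and pb_in: "\<Gamma> \<in> Obj (cs_cat S) \<Longrightarrow> cs_len S \<Gamma> > 0 \<Longrightarrow>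
        f \<in> Hom (cs_cat S) \<Delta> (cs_ft S \<Gamma>) \<Longrightarrow> cs_pb S f \<Gamma> \<in> Obj (cs_cat S)"
    and q_in: "\<Gamma> \<in> Obj (cs_cat S) \<Longrightarrow> cs_len S \<Gamma> > 0 \<Longrightarrow>
        f \<in> Hom (cs_cat S) \<Delta> (cs_ft S \<Gamma>) \<Longrightarrow>
        cs_q S f \<Gamma> \<in> Hom (cs_cat S) (cs_pb S f \<Gamma>) \<Gamma>"
    and len_zero: "\<Gamma> \<in> Obj (cs_cat S) \<Longrightarrow> cs_len S \<Gamma> = 0 \<longleftrightarrow> \<Gamma> = cs_one S"
    and len_ft: "\<Gamma> \<in> Obj (cs_cat S) \<Longrightarrow> cs_len S \<Gamma> > 0 \<Longrightarrow>
        cs_len S (cs_ft S \<Gamma>) = cs_len S \<Gamma> - 1"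
    and ft_one: "cs_ft S (cs_one S) = cs_one S"
    and one_terminal: "terminal (cs_cat S) (cs_one S)"
    and len_pb: "\<Gamma> \<in> Obj (cs_cat S) \<Longrightarrow> cs_len S \<Gamma> > 0 \<Longrightarrow>
        f \<in> Hom (cs_cat S) \<Delta> (cs_ft S \<Gamma>) \<Longrightarrow> cs_len S (cs_pb S f \<Gamma>) > 0"
    and ft_pb: "\<Gamma> \<in> Obj (cs_cat S) \<Longrightarrow> cs_len S \<Gamma> > 0 \<Longrightarrow>
        f \<in> Hom (cs_cat S) \<Delta> (cs_ft S \<Gamma>) \<Longrightarrow> cs_ft S (cs_pb S f \<Gamma>) = \<Delta>"
    and pb_pullback: "\<Gamma> \<in> Obj (cs_cat S) \<Longrightarrow> cs_len S \<Gamma> > 0 \<Longrightarrow>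
        f \<in> Hom (cs_cat S) \<Delta> (cs_ft S \<Gamma>) \<Longrightarrow>
        pullback (cs_cat S) (cs_p S \<Gamma>) f (cs_q S f \<Gamma>) (cs_p S (cs_pb S f \<Gamma>))"
    and pb_Idt: "\<Gamma> \<in> Obj (cs_cat S) \<Longrightarrow> cs_len S \<Gamma> > 0 \<Longrightarrow>
        cs_pb S (Idt (cs_cat S) (cs_ft S \<Gamma>)) \<Gamma> = \<Gamma>"
    and q_Idt: "\<Gamma> \<in> Obj (cs_cat S) \<Longrightarrow> cs_len S \<Gamma> > 0 \<Longrightarrow>
        cs_q S (Idt (cs_cat S) (cs_ft S \<Gamma>)) \<Gamma> = Idt (cs_cat S) \<Gamma>"
    and pb_Comp: "\<Gamma> \<in> Obj (cs_cat S) \<Longrightarrow> cs_len S \<Gamma> > 0 \<Longrightarrow>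
        g \<in> Hom (cs_cat S) \<Delta> (cs_ft S \<Gamma>) \<Longrightarrow> f \<in> Hom (cs_cat S) E \<Delta> \<Longrightarrow>
        cs_pb S (Comp (cs_cat S) g f) \<Gamma> = cs_pb S f (cs_pb S g \<Gamma>)"
    and q_Comp: "\<Gamma> \<in> Obj (cs_cat S) \<Longrightarrow> cs_len S \<Gamma> > 0 \<Longrightarrow>
        g \<in> Hom (cs_cat S) \<Delta> (cs_ft S \<Gamma>) \<Longrightarrow> f \<in> Hom (cs_cat S) E \<Delta> \<Longrightarrow>
        cs_q S (Comp (cs_cat S) g f) \<Gamma> =
          Comp (cs_cat S) (cs_q S g \<Gamma>) (cs_q S f (cs_pb S g \<Gamma>))"

locale csys_hom = src: c_system S + tgt: c_system T + is_functor "cs_cat S" "cs_cat T" F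
  for S :: "('o, 'a) csys" and T :: "('o2, 'a2) csys" and F :: "('o, 'a, 'o2, 'a2) ftr" +
  assumes extensional: "extensional_ftr (cs_cat S) F"
    and pres_one: "OMap F (cs_one S) = cs_one T"
    and pres_len: "\<Gamma> \<in> Obj (cs_cat S) \<Longrightarrow> cs_len T (OMap F \<Gamma>) = cs_len S \<Gamma>"
    and pres_ft: "\<Gamma> \<in> Obj (cs_cat S) \<Longrightarrow> OMap F (cs_ft S \<Gamma>) = cs_ft T (OMap F \<Gamma>)"
    and pres_p: "\<Gamma> \<in> Obj (cs_cat S) \<Longrightarrow> cs_len S \<Gamma> > 0 \<Longrightarrow>
        AMap F (cs_p S \<Gamma>) = cs_p T (OMap F \<Gamma>)"
    and pres_pb: "\<Gamma> \<in> Obj (cs_cat S) \<Longrightarrow> cs_len S \<Gamma> > 0 \<Longrightarrow>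
        f \<in> Hom (cs_cat S) \<Delta> (cs_ft S \<Gamma>) \<Longrightarrow>
        OMap F (cs_pb S f \<Gamma>) = cs_pb T (AMap F f) (OMap F \<Gamma>)"
    and pres_q: "\<Gamma> \<in> Obj (cs_cat S) \<Longrightarrow> cs_len S \<Gamma> > 0 \<Longrightarrow>
        f \<in> Hom (cs_cat S) \<Delta> (cs_ft S \<Gamma>) \<Longrightarrow>
        AMap F (cs_q S f \<Gamma>) = cs_q T (AMap F f) (OMap F \<Gamma>)"

text \<open>An arrow of the category of C-systems is a morphism together with its domain and codomain.\<close>

type_synonym ('o, 'a) csys_arr = "('o, 'a) csys \<times> ('o, 'a, 'o, 'a) ftr \<times> ('o, 'a) csys"

definition Csys :: "(('o, 'a) csys, ('o, 'a) csys_arr) cat" where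
  "Csys =
     \<lparr>Obj = {S. c_system S},
      Arr = {(S, F, T). csys_hom S T F},
      Dom = (\<lambda>(S, F, T). S),
      Cod = (\<lambda>(S, F, T). T),
      Idt = (\<lambda>S. (S, restrict_ftr (cs_cat S) id_ftr, S)),
      Comp = (\<lambda>(T', G, U) (S, F, T). (S, restrict_ftr (cs_cat S) (comp_ftr G F), U))\<rparr>"


section \<open>CE-systems\<close>

text \<open>
  The two categories share their objects, and \<open>ce_I\<close> is the action on arrows of the
  identity-on-objects functor from \<open>ce_F\<close> to \<open>ce_C\<close>. For \<open>A\<close> in the slice of \<open>ce_F\<close> over
  \<open>\<Gamma>\<close>, the object \<open>\<Gamma>.A\<close> is the domain of \<open>A\<close>, and \<open>A.P\<close> is the composite \<open>A \<circ> P\<close>.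
\<close>

record ('o, 'f, 'a) cesys =
  ce_F :: "('o, 'f) cat"
  ce_C :: "('o, 'a) cat"
  ce_I :: "'f \<Rightarrow> 'a"
  ce_one :: 'o
  ce_pb :: "'a \<Rightarrow> 'f \<Rightarrow> 'f"
  ce_pi2 :: "'a \<Rightarrow> 'f \<Rightarrow> 'a"

definition ce_I_ftr :: "('o, 'f, 'a) cesys \<Rightarrow> ('o, 'f, 'o, 'a) ftr" where
  "ce_I_ftr S = \<lparr>OMap = (\<lambda>X. X), AMap = ce_I S\<rparr>"

locale ce_system =
  fixes S :: "('o, 'f, 'a) cesys"
  assumes Obj_eq: "Obj (ce_F S) = Obj (ce_C S)"
    and I_functor: "is_functor (ce_F S) (ce_C S) (ce_I_ftr S)"
    and one_terminal: "terminal (ce_F S) (ce_one S)"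
    and pb_in: "f \<in> Hom (ce_C S) \<Delta> \<Gamma> \<Longrightarrow> A \<in> slice (ce_F S) \<Gamma> \<Longrightarrow>
        ce_pb S f A \<in> slice (ce_F S) \<Delta>"
    and pi2_in: "f \<in> Hom (ce_C S) \<Delta> \<Gamma> \<Longrightarrow> A \<in> slice (ce_F S) \<Gamma> \<Longrightarrow>
        ce_pi2 S f A \<in> Hom (ce_C S) (Dom (ce_F S) (ce_pb S f A)) (Dom (ce_F S) A)"
    and pb_pullback: "f \<in> Hom (ce_C S) \<Delta> \<Gamma> \<Longrightarrow> A \<in> slice (ce_F S) \<Gamma> \<Longrightarrow>
        pullback (ce_C S) (ce_I S A) f (ce_pi2 S f A) (ce_I S (ce_pb S f A))"
    and pb_of_Idt: "f \<in> Hom (ce_C S) \<Delta> \<Gamma> \<Longrightarrow>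
        ce_pb S f (Idt (ce_F S) \<Gamma>) = Idt (ce_F S) \<Delta>"
    and pi2_of_Idt: "f \<in> Hom (ce_C S) \<Delta> \<Gamma> \<Longrightarrow> ce_pi2 S f (Idt (ce_F S) \<Gamma>) = f"
    and pb_along_Idt: "\<Gamma> \<in> Obj (ce_C S) \<Longrightarrow> A \<in> slice (ce_F S) \<Gamma> \<Longrightarrow>
        ce_pb S (Idt (ce_C S) \<Gamma>) A = A"
    and pi2_along_Idt: "\<Gamma> \<in> Obj (ce_C S) \<Longrightarrow> A \<in> slice (ce_F S) \<Gamma> \<Longrightarrow>
        ce_pi2 S (Idt (ce_C S) \<Gamma>) A = Idt (ce_C S) (Dom (ce_F S) A)"
    and pb_along_Comp: "f \<in> Hom (ce_C S) \<Delta> \<Gamma> \<Longrightarrow> g \<in> Hom (ce_C S) E \<Delta> \<Longrightarrow>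
        A \<in> slice (ce_F S) \<Gamma> \<Longrightarrow>
        ce_pb S (Comp (ce_C S) f g) A = ce_pb S g (ce_pb S f A)"
    and pi2_along_Comp: "f \<in> Hom (ce_C S) \<Delta> \<Gamma> \<Longrightarrow> g \<in> Hom (ce_C S) E \<Delta> \<Longrightarrow>
        A \<in> slice (ce_F S) \<Gamma> \<Longrightarrow>
        ce_pi2 S (Comp (ce_C S) f g) A = Comp (ce_C S) (ce_pi2 S f A) (ce_pi2 S g (ce_pb S f A))"
    and pb_of_Comp: "f \<in> Hom (ce_C S) \<Delta> \<Gamma> \<Longrightarrow> A \<in> slice (ce_F S) \<Gamma> \<Longrightarrow>
        P \<in> slice (ce_F S) (Dom (ce_F S) A) \<Longrightarrow>
        ce_pb S f (Comp (ce_F S) A P) =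
          Comp (ce_F S) (ce_pb S f A) (ce_pb S (ce_pi2 S f A) P)"
    and pi2_of_Comp: "f \<in> Hom (ce_C S) \<Delta> \<Gamma> \<Longrightarrow> A \<in> slice (ce_F S) \<Gamma> \<Longrightarrow>
        P \<in> slice (ce_F S) (Dom (ce_F S) A) \<Longrightarrow>
        ce_pi2 S f (Comp (ce_F S) A P) = ce_pi2 S (ce_pi2 S f A) P"

locale rooted_ce_system = ce_system S
  for S :: "('o, 'f, 'a) cesys" +
  assumes rooted: "terminal (ce_C S) (ce_one S)"

definition stratified_ce :: "('o, 'f, 'a) cesys \<Rightarrow> bool" where
  "stratified_ce S \<longleftrightarrow>
     (\<exists>L. stratification (ce_F S) (ce_one S) L \<and>
        (\<forall>\<Delta> \<Gamma>. \<forall>f \<in> Hom (ce_C S) \<Delta> \<Gamma>. \<forall>A \<in> slice (ce_F S) \<Gamma>.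
           slice_level (ce_F S) L A = slice_level (ce_F S) L (ce_pb S f A)))"

record ('o, 'f, 'a, 'o2, 'f2, 'a2) ceftr =
  FF :: "('o, 'f, 'o2, 'f2) ftr"
  FC :: "('o, 'a, 'o2, 'a2) ftr"

locale ce_hom = src: ce_system S + tgt: ce_system T +
    F: is_functor "ce_F S" "ce_F T" "FF H" + C: is_functor "ce_C S" "ce_C T" "FC H"
  for S :: "('o, 'f, 'a) cesys" and T :: "('o2, 'f2, 'a2) cesys"
    and H :: "('o, 'f, 'a, 'o2, 'f2, 'a2) ceftr" +
  assumes extensional_F: "extensional_ftr (ce_F S) (FF H)"
    and extensional_C: "extensional_ftr (ce_C S) (FC H)"
    and I_Obj: "X \<in> Obj (ce_F S) \<Longrightarrow> OMap (FC H) X = OMap (FF H) X"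
    and I_Arr: "A \<in> Arr (ce_F S) \<Longrightarrow> AMap (FC H) (ce_I S A) = ce_I T (AMap (FF H) A)"
    and pres_one: "OMap (FF H) (ce_one S) = ce_one T"
    and pres_pb: "f \<in> Hom (ce_C S) \<Delta> \<Gamma> \<Longrightarrow> A \<in> slice (ce_F S) \<Gamma> \<Longrightarrow>
        AMap (FF H) (ce_pb S f A) = ce_pb T (AMap (FC H) f) (AMap (FF H) A)"
    and pres_pi2: "f \<in> Hom (ce_C S) \<Delta> \<Gamma> \<Longrightarrow> A \<in> slice (ce_F S) \<Gamma> \<Longrightarrow>
        AMap (FC H) (ce_pi2 S f A) = ce_pi2 T (AMap (FC H) f) (AMap (FF H) A)"

definition stratified_ce_hom ::
    "('o, 'f, 'a) cesys \<Rightarrow> ('o2, 'f2, 'a2) cesys \<Rightarrow> ('o, 'f, 'a, 'o2, 'f2, 'a2) ceftr \<Rightarrow> bool" where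
  "stratified_ce_hom S T H \<longleftrightarrow>
     ce_hom S T H \<and> stratified_functor (ce_F S) (ce_one S) (ce_F T) (ce_one T) (FF H)"

type_synonym ('o, 'f, 'a) ce_arr =
  "('o, 'f, 'a) cesys \<times> ('o, 'f, 'a, 'o, 'f, 'a) ceftr \<times> ('o, 'f, 'a) cesys"

definition rCEsys :: "(('o, 'f, 'a) cesys, ('o, 'f, 'a) ce_arr) cat" where
  "rCEsys =
     \<lparr>Obj = {S. rooted_ce_system S \<and> stratified_ce S},
      Arr = {(S, H, T). rooted_ce_system S \<and> stratified_ce S \<and>
               rooted_ce_system T \<and> stratified_ce T \<and> stratified_ce_hom S T H},
      Dom = (\<lambda>(S, H, T). S),
      Cod = (\<lambda>(S, H, T). T),
      Idt = (\<lambda>S. (S, \<lparr>FF = restrict_ftr (ce_F S) id_ftr, FC = restrict_ftr (ce_C S) id_ftr\<rparr>, S)),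
      Comp = (\<lambda>(T', K, U) (S, H, T).
        (S, \<lparr>FF = restrict_ftr (ce_F S) (comp_ftr (FF K) (FF H)),
             FC = restrict_ftr (ce_C S) (comp_ftr (FC K) (FC H))\<rparr>, U))\<rparr>"


section \<open>The functor from C-systems to CE-systems\<close>

text \<open>The graph of canonical projections; the edge \<open>p\<^sub>\<Gamma>\<close> is represented by \<open>\<Gamma>\<close> itself.\<close>

definition p_graph :: "('o, 'a) csys \<Rightarrow> ('o, 'o) graph" where
  "p_graph S =
     \<lparr>Obj = Obj (cs_cat S),
      Arr = {\<Gamma> \<in> Obj (cs_cat S). cs_len S \<Gamma> > 0},
      Dom = (\<lambda>\<Gamma>. \<Gamma>),
      Cod = cs_ft S\<rparr>"

text \<open>
  \<open>pb_path S f es\<close> computes the list of edges of \<open>f\<^sup>*p\<close> and the arrow \<open>\<pi>\<^sub>2(f, p)\<close>, where \<open>p\<close> is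
  the path with edges \<open>es\<close>; as the first edge of the list is traversed first, \<open>\<Xi> # es\<close>
  stands for \<open>p' \<circ> p\<^sub>\<Xi>\<close> with \<open>p'\<close> given by \<open>es\<close>.
\<close>

primrec pb_path :: "('o, 'a) csys \<Rightarrow> 'a \<Rightarrow> 'o list \<Rightarrow> 'o list \<times> 'a" where
  "pb_path S f [] = ([], f)"
| "pb_path S f (\<Xi> # es) =
     (case pb_path S f es of (es', g) \<Rightarrow> (cs_pb S g \<Xi> # es', cs_q S g \<Xi>))"

definition CE_obj ::
    "('o \<times> 'o list \<times> 'o \<Rightarrow> 'f) \<Rightarrow> ('o, 'a) csys \<Rightarrow> ('o, 'f, 'a) cesys" where
  "CE_obj enc S =
     \<lparr>ce_F = free_category enc (p_graph S),
      ce_C = cs_cat S,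
      ce_I = (\<lambda>a. case inv enc a of (X, es, Y) \<Rightarrow> composite (cs_cat S) X (map (cs_p S) es)),
      ce_one = cs_one S,
      ce_pb = (\<lambda>f a. case inv enc a of (X, es, Y) \<Rightarrow>
                 case pb_path S f es of (es', g) \<Rightarrow>
                   enc (Dom (cs_cat S) g, es', Dom (cs_cat S) f)),
      ce_pi2 = (\<lambda>f a. case inv enc a of (X, es, Y) \<Rightarrow> snd (pb_path S f es))\<rparr>"

definition free_map ::
    "('o \<times> 'o list \<times> 'o \<Rightarrow> 'f) \<Rightarrow> ('o, 'a) csys \<Rightarrow> ('o, 'a, 'o, 'a) ftr \<Rightarrow> ('o, 'f, 'o, 'f) ftr"
  where
  "free_map enc S F =
     restrict_ftr (free_category enc (p_graph S))
       \<lparr>OMap = OMap F,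
        AMap = (\<lambda>a. case inv enc a of (X, es, Y) \<Rightarrow>
                  enc (OMap F X, map (OMap F) es, OMap F Y))\<rparr>"

definition CE ::
    "('o \<times> 'o list \<times> 'o \<Rightarrow> 'f) \<Rightarrow>
      (('o, 'a) csys, ('o, 'a) csys_arr, ('o, 'f, 'a) cesys, ('o, 'f, 'a) ce_arr) ftr" where
  "CE enc =
     \<lparr>OMap = CE_obj enc,
      AMap = (\<lambda>(S, F, T). (CE_obj enc S, \<lparr>FF = free_map enc S F, FC = F\<rparr>, CE_obj enc T))\<rparr>"

end

theory Submission
  imports Defs
begin

text \<open>
  A stratification amounts to saying that every arrow factors uniquely into arrows that lower
  the level by exactly one, and that out of every object of positive level there is exactly one
  such arrow. So a stratified category is free on the graph of these arrows, and \<open>CE\<close> is seen to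
  be fully faithful and essentially surjective: faithful because a CE-homomorphism in its image
  contains the C-system morphism as a component, full because a stratified functor between free
  categories must map edges to edges, and essentially surjective because the unit arrows of a
  stratified CE-system are the canonical projections of a C-system on its second category.
\<close>

section \<open>Categories\<close>

text \<open>The C-system extracted from a CE-system \<open>T\<close> keeps the second category of
  \<open>T\<close>, but its image under \<open>CE\<close> has names of paths, chosen by
  \<open>enc\<close>, as first category. It is therefore only isomorphic to \<open>T\<close>. The
  comparison evaluates a path as a composite of unit arrows and is the identity on objects and on
  \<open>ce_C T\<close>, so essential surjectivity comes down to a bijection between the arrows of
  the two first categories. The hypothesis that the pullback functors are stratified enters at one
  point: the chosen pullback of a unit arrow lowers the level by one, hence is the unit arrow out of
  its own domain. Axiom (d) then determines the pullbacks of all arrows from those of unit arrows,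
  so the recursion over paths in \<open>CE\<close> recovers the choices made in \<open>T\<close>.
  Levels are quantified existentially in \<open>stratified_ce\<close> and in
  \<open>stratified_functor\<close>, and different witnesses have to be compared. This is why
  uniqueness of stratifications on objects is proved and used.\<close>

lemma HomI: "f \<in> Arr C \<Longrightarrow> Dom C f = X \<Longrightarrow> Cod C f = Y \<Longrightarrow> f \<in> Hom C X Y"
  by (simp add: Hom_def)

lemma HomD: "f \<in> Hom C X Y \<Longrightarrow> f \<in> Arr C" "f \<in> Hom C X Y \<Longrightarrow> Dom C f = X"
    "f \<in> Hom C X Y \<Longrightarrow> Cod C f = Y"
  by (auto simp: Hom_def)

lemma Arr_Hom: "f \<in> Arr C \<Longrightarrow> f \<in> Hom C (Dom C f) (Cod C f)"
  by (simp add: Hom_def)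

lemma slice_iff: "A \<in> slice C X \<longleftrightarrow> A \<in> Hom C (Dom C A) X"
  by (auto simp: slice_def Hom_def)

lemma Hom_slice: "A \<in> Hom C Y X \<Longrightarrow> A \<in> slice C X"
  by (auto simp: slice_def Hom_def)

lemma path_Obj: "path G X es Y \<Longrightarrow> X \<in> Obj G" "path G X es Y \<Longrightarrow> Y \<in> Obj G"
  by (induction es arbitrary: X) auto

lemma path_append: "path G X (es @ es') Z \<longleftrightarrow> (\<exists>Y. path G X es Y \<and> path G Y es' Z)"
  by (induction es arbitrary: X) (auto dest: path_Obj)

lemma terminal_arr_unique:
  "terminal C t \<Longrightarrow> X \<in> Obj C \<Longrightarrow> f \<in> Hom C X t \<Longrightarrow> g \<in> Hom C X t \<Longrightarrow> f = g"
  by (auto simp: terminal_def)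

context category begin

lemma Hom_Obj: "f \<in> Hom C X Y \<Longrightarrow> X \<in> Obj C" "f \<in> Hom C X Y \<Longrightarrow> Y \<in> Obj C"
  using Dom_in Cod_in by (auto simp: Hom_def)

lemma composite_in: "path C X gs Y \<Longrightarrow> composite C X gs \<in> Hom C X Y"
  by (induction gs arbitrary: X) (auto intro!: Idt_in Comp_in intro: HomI)

lemma composite_append:
  "path C X gs Y \<Longrightarrow> path C Y hs Z \<Longrightarrow>
    composite C X (gs @ hs) = Comp C (composite C Y hs) (composite C X gs)"
proof (induction gs arbitrary: X)
  case Nil
  then show ?case by (auto simp: Comp_Idt[OF composite_in])
next
  case (Cons g gs)
  then have g: "g \<in> Hom C X (Cod C g)" and gs: "path C (Cod C g) gs Y"
    by (auto intro: HomI)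
  show ?case
    using Cons.IH[OF gs Cons.prems(2)]
      Comp_assoc[OF g composite_in[OF gs] composite_in[OF Cons.prems(2)]] by simp
qed

lemma composite_single: "g \<in> Hom C X Y \<Longrightarrow> composite C X [g] = g"
  using Idt_Comp by (auto simp: HomD)

lemma iso_arrI:
  "f \<in> Hom C X Y \<Longrightarrow> g \<in> Hom C Y X \<Longrightarrow> Comp C g f = Idt C X \<Longrightarrow> Comp C f g = Idt C Y \<Longrightarrow>
    iso_arr C f"
  by (auto simp: iso_arr_def Hom_def)

lemma iso_arrE:
  assumes "iso_arr C f" "f \<in> Hom C X Y"
  obtains g where "g \<in> Hom C Y X" "Comp C g f = Idt C X" "Comp C f g = Idt C Y"
  using assms by (auto simp: iso_arr_def HomD)

lemma pullbackI:
  assumes "f \<in> Hom C A Z" "g \<in> Hom C B Z" "p \<in> Hom C P A" "q \<in> Hom C P B"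
    and "Comp C f p = Comp C g q"
    and "\<And>W u v. u \<in> Hom C W A \<Longrightarrow> v \<in> Hom C W B \<Longrightarrow> Comp C f u = Comp C g v \<Longrightarrow>
      \<exists>!h. h \<in> Hom C W P \<and> Comp C p h = u \<and> Comp C q h = v"
  shows "pullback C f g p q"
  using assms unfolding pullback_def by (auto simp: HomD)

lemma pullbackD:
  assumes "pullback C f g p q" "f \<in> Hom C A Z" "g \<in> Hom C B Z" "p \<in> Hom C P A" "q \<in> Hom C P B"
  shows "Comp C f p = Comp C g q"
    and "u \<in> Hom C W A \<Longrightarrow> v \<in> Hom C W B \<Longrightarrow> Comp C f u = Comp C g v \<Longrightarrow>
      \<exists>!h. h \<in> Hom C W P \<and> Comp C p h = u \<and> Comp C q h = v"
  using assms Hom_Obj[of u W A] unfolding pullback_def by (auto simp: HomD)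

text \<open>The degenerate square over an identity: the base case when pullbacks along a path are
  built edge by edge.\<close>

lemma pullback_Idt:
  assumes f: "f \<in> Hom C X Y"
  shows "pullback C (Idt C Y) f f (Idt C X)"
proof (rule pullbackI[OF _ f f])
  show "Idt C Y \<in> Hom C Y Y" "Idt C X \<in> Hom C X X" using Idt_in Hom_Obj[OF f] by auto
  show "Comp C (Idt C Y) f = Comp C f (Idt C X)" using f by (simp add: Idt_Comp Comp_Idt)
  fix W u v assume "u \<in> Hom C W Y" "v \<in> Hom C W X" "Comp C (Idt C Y) u = Comp C f v"
  then show "\<exists>!h. h \<in> Hom C W X \<and> Comp C f h = u \<and> Comp C (Idt C X) h = v"
    by (metis Idt_Comp)
qed

text \<open>Pasting law: the two squares share the side \<open>g\<close>. A cone is first factored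
  through \<open>W\<close> by the square over \<open>p1\<close>, and the resulting arrow is then
  lifted to \<open>V\<close> by the square over \<open>p2\<close>.\<close>

lemma pullback_paste:
  assumes p1: "p1 \<in> Hom C A \<Gamma>" and f: "f \<in> Hom C \<Delta> \<Gamma>" and g: "g \<in> Hom C W A"
    and r1: "r1 \<in> Hom C W \<Delta>" and pb1: "pullback C p1 f g r1"
    and p2: "p2 \<in> Hom C B A" and h: "h \<in> Hom C V B" and r2: "r2 \<in> Hom C V W"
    and pb2: "pullback C p2 g h r2"
  shows "pullback C (Comp C p1 p2) f h (Comp C r1 r2)"
proof (rule pullbackI[OF Comp_in[OF p2 p1] f h Comp_in[OF r2 r1]])
  note D1 = pullbackD[OF pb1 p1 f g r1] and D2 = pullbackD[OF pb2 p2 g h r2]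
  show "Comp C (Comp C p1 p2) h = Comp C f (Comp C r1 r2)"
    using Comp_assoc[OF h p2 p1] D2(1) Comp_assoc[OF r2 g p1] D1(1) Comp_assoc[OF r2 r1 f] by simp
  fix Z u v
  assume u: "u \<in> Hom C Z B" and v: "v \<in> Hom C Z \<Delta>" and e: "Comp C (Comp C p1 p2) u = Comp C f v"
  have "Comp C p1 (Comp C p2 u) = Comp C f v" using e Comp_assoc[OF u p2 p1] by simp
  from D1(2)[OF Comp_in[OF u p2] v this]
  obtain k where k: "k \<in> Hom C Z W" "Comp C g k = Comp C p2 u" "Comp C r1 k = v"
    and k1: "\<And>k'. k' \<in> Hom C Z W \<Longrightarrow> Comp C g k' = Comp C p2 u \<Longrightarrow> Comp C r1 k' = v \<Longrightarrow> k' = k"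
    by blast
  from D2(2)[OF u k(1) k(2)[symmetric]]
  obtain l where l: "l \<in> Hom C Z V" "Comp C h l = u" "Comp C r2 l = k"
    and l1: "\<And>l'. l' \<in> Hom C Z V \<Longrightarrow> Comp C h l' = u \<Longrightarrow> Comp C r2 l' = k \<Longrightarrow> l' = l"
    by blast
  show "\<exists>!h'. h' \<in> Hom C Z V \<and> Comp C h h' = u \<and> Comp C (Comp C r1 r2) h' = v"
  proof (rule ex1I[of _ l])
    show "l \<in> Hom C Z V \<and> Comp C h l = u \<and> Comp C (Comp C r1 r2) l = v"
      using l k Comp_assoc[OF l(1) r2 r1] by simp
    fix l' assume l': "l' \<in> Hom C Z V \<and> Comp C h l' = u \<and> Comp C (Comp C r1 r2) l' = v"
    then have m: "l' \<in> Hom C Z V" by blast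
    \<comment> \<open>Uniqueness also goes through \<open>W\<close>: \<open>Comp C r2 l'\<close>
      must be the first mediating arrow \<open>k\<close>, and then \<open>l'\<close> must be
      \<open>l\<close>.\<close>
    have "Comp C g (Comp C r2 l') = Comp C p2 u"
      using Comp_assoc[OF m r2 g] Comp_assoc[OF m h p2] D2(1) l' by simp
    moreover have "Comp C r1 (Comp C r2 l') = v" using Comp_assoc[OF m r2 r1] l' by simp
    ultimately show "l' = l" using l1 k1[OF Comp_in[OF m r2]] l' by blast
  qed
qed

end


section \<open>Fully faithful and essentially surjective functors\<close>

lemma extensional_ftr_restrict: "extensional_ftr C (restrict_ftr C F)"
  by (simp add: extensional_ftr_def restrict_ftr_def)

lemma restrict_ftr_apply [simp]:
  "X \<in> Obj C \<Longrightarrow> OMap (restrict_ftr C F) X = OMap F X"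
  "f \<in> Arr C \<Longrightarrow> AMap (restrict_ftr C F) f = AMap F f"
  by (auto simp: restrict_ftr_def)

lemma extensional_ftr_eqI:
  assumes "extensional_ftr C F" "extensional_ftr C G"
    and "\<And>X. X \<in> Obj C \<Longrightarrow> OMap F X = OMap G X" "\<And>f. f \<in> Arr C \<Longrightarrow> AMap F f = AMap G f"
  shows "F = G"
  using assms unfolding extensional_ftr_def
  by (intro ftr.equality extensionalityI) auto

lemma is_functorI:
  assumes "category C" "category D"
    and "\<And>X. X \<in> Obj C \<Longrightarrow> OMap F X \<in> Obj D"
    and "\<And>f X Y. f \<in> Hom C X Y \<Longrightarrow> AMap F f \<in> Hom D (OMap F X) (OMap F Y)"
    and "\<And>X. X \<in> Obj C \<Longrightarrow> AMap F (Idt C X) = Idt D (OMap F X)"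
    and "\<And>f g X Y Z. f \<in> Hom C X Y \<Longrightarrow> g \<in> Hom C Y Z \<Longrightarrow>
      AMap F (Comp C g f) = Comp D (AMap F g) (AMap F f)"
  shows "is_functor C D F"
  using assms unfolding is_functor_def is_functor_axioms_def by blast

lemma is_functor_id: "category C \<Longrightarrow> is_functor C C id_ftr"
  by (rule is_functorI) (auto simp: id_ftr_def)

lemma is_functor_comp:
  assumes "is_functor C D F" "is_functor D E G"
  shows "is_functor C E (comp_ftr G F)"
proof -
  interpret F: is_functor C D F by fact
  interpret G: is_functor D E G by fact
  show ?thesis
  proof (rule is_functorI)
    fix f g X Y Z assume fg: "f \<in> Hom C X Y" "g \<in> Hom C Y Z"
    show "AMap (comp_ftr G F) (Comp C g f) =
        Comp E (AMap (comp_ftr G F) g) (AMap (comp_ftr G F) f)"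
      using F.AMap_Comp[OF fg] G.AMap_Comp[OF F.AMap_in[OF fg(1)] F.AMap_in[OF fg(2)]]
      by (simp add: comp_ftr_def)
  qed (auto simp: comp_ftr_def F.src.category_axioms G.tgt.category_axioms F.OMap_in G.OMap_in
        F.AMap_Idt G.AMap_Idt intro: G.AMap_in F.AMap_in)
qed

lemma is_functor_restrict:
  assumes "is_functor C D F"
  shows "is_functor C D (restrict_ftr C F)"
proof -
  interpret is_functor C D F by fact
  show ?thesis
  proof (rule is_functorI)
    fix f X Y assume f: "f \<in> Hom C X Y"
    then show "AMap (restrict_ftr C F) f
        \<in> Hom D (OMap (restrict_ftr C F) X) (OMap (restrict_ftr C F) Y)"
      using AMap_in[OF f] by (simp add: HomD src.Hom_Obj)
  next
    fix X assume "X \<in> Obj C"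
    then show "AMap (restrict_ftr C F) (Idt C X) = Idt D (OMap (restrict_ftr C F) X)"
      using src.Idt_in[of X] by (simp add: HomD AMap_Idt)
  next
    fix f g X Y Z assume fg: "f \<in> Hom C X Y" "g \<in> Hom C Y Z"
    show "AMap (restrict_ftr C F) (Comp C g f) =
        Comp D (AMap (restrict_ftr C F) g) (AMap (restrict_ftr C F) f)"
      using fg src.Comp_in[OF fg] by (simp add: HomD AMap_Comp)
  qed (auto simp: src.category_axioms tgt.category_axioms OMap_in)
qed

lemma (in is_functor) AMap_composite:
  "path C X gs Y \<Longrightarrow> AMap F (composite C X gs) = composite D (OMap F X) (map (AMap F) gs)"
proof (induction gs arbitrary: X)
  case (Cons g gs)
  then have g: "g \<in> Hom C X (Cod C g)" by (auto intro: HomI)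
  note HomD[OF AMap_in[OF g]] AMap_Comp[OF g src.composite_in[of "Cod C g" gs Y]]
  with Cons show ?case by simp
qed (auto simp: AMap_Idt)

text \<open>The quasi-inverse is obtained by choice. Equations between arrows of \<open>C\<close>
  are checked after applying the faithful \<open>F\<close> and composing with the isomorphisms
  \<open>e\<close>, which can be cancelled.\<close>

lemma (in is_functor) equivalenceI:
  assumes faithful: "\<And>X Y f g. f \<in> Hom C X Y \<Longrightarrow> g \<in> Hom C X Y \<Longrightarrow> AMap F f = AMap F g \<Longrightarrow> f = g"
    and full: "\<And>X Y h. X \<in> Obj C \<Longrightarrow> Y \<in> Obj C \<Longrightarrow> h \<in> Hom D (OMap F X) (OMap F Y) \<Longrightarrow>
      \<exists>f \<in> Hom C X Y. AMap F f = h"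
    and ess_surj: "\<And>Y. Y \<in> Obj D \<Longrightarrow> \<exists>X \<in> Obj C. \<exists>e \<in> Hom D (OMap F X) Y. iso_arr D e"
  shows "equivalence_of_categories C D F"
proof -
  have "\<forall>Y\<in>Obj D. \<exists>X e e'. X \<in> Obj C \<and> e \<in> Hom D (OMap F X) Y \<and> e' \<in> Hom D Y (OMap F X) \<and>
      Comp D e' e = Idt D (OMap F X) \<and> Comp D e e' = Idt D Y"
    using ess_surj by (meson tgt.iso_arrE)
  then obtain GO e e' where "\<forall>Y\<in>Obj D. GO Y \<in> Obj C \<and> e Y \<in> Hom D (OMap F (GO Y)) Y \<and>
      e' Y \<in> Hom D Y (OMap F (GO Y)) \<and> Comp D (e' Y) (e Y) = Idt D (OMap F (GO Y)) \<and>
      Comp D (e Y) (e' Y) = Idt D Y"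
    by metis
  then have GO: "\<And>Y. Y \<in> Obj D \<Longrightarrow> GO Y \<in> Obj C"
    and e: "\<And>Y. Y \<in> Obj D \<Longrightarrow> e Y \<in> Hom D (OMap F (GO Y)) Y"
    and e': "\<And>Y. Y \<in> Obj D \<Longrightarrow> e' Y \<in> Hom D Y (OMap F (GO Y))"
    and e'e: "\<And>Y. Y \<in> Obj D \<Longrightarrow> Comp D (e' Y) (e Y) = Idt D (OMap F (GO Y))"
    and ee': "\<And>Y. Y \<in> Obj D \<Longrightarrow> Comp D (e Y) (e' Y) = Idt D Y"
    by blast+
  \<comment> \<open>Conjugation by the chosen isomorphisms, followed by the choice of a preimage
    under the full functor \<open>F\<close>.\<close>
  define GA where "GA g = (SOME f. f \<in> Hom C (GO (Dom D g)) (GO (Cod D g)) \<and>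
      AMap F f = Comp D (e' (Cod D g)) (Comp D g (e (Dom D g))))" for g
  have GA: "GA g \<in> Hom C (GO X) (GO Y)" "AMap F (GA g) = Comp D (e' Y) (Comp D g (e X))"
    if g: "g \<in> Hom D X Y" for g X Y
  proof -
    have XY: "X \<in> Obj D" "Y \<in> Obj D" using g by (auto simp: tgt.Hom_Obj)
    have "Comp D (e' Y) (Comp D g (e X)) \<in> Hom D (OMap F (GO X)) (OMap F (GO Y))"
      using tgt.Comp_in[OF tgt.Comp_in[OF e[OF XY(1)] g] e'[OF XY(2)]] .
    from full[OF GO[OF XY(1)] GO[OF XY(2)] this]
    have "\<exists>f. f \<in> Hom C (GO X) (GO Y) \<and> AMap F f = Comp D (e' Y) (Comp D g (e X))" by blast
    from someI_ex[OF this]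
    show "GA g \<in> Hom C (GO X) (GO Y)" "AMap F (GA g) = Comp D (e' Y) (Comp D g (e X))"
      unfolding GA_def using g by (auto simp: HomD)
  qed
  \<comment> \<open>Naturality of \<open>e\<close>. Together with \<open>e_cancel\<close> and
    faithfulness it pins down \<open>GA g\<close>, so the functor laws follow without looking into
    the choice.\<close>
  have e_GA: "Comp D (e Y) (AMap F (GA g)) = Comp D g (e X)" if g: "g \<in> Hom D X Y" for g X Y
  proof -
    have XY: "X \<in> Obj D" "Y \<in> Obj D" using g by (auto simp: tgt.Hom_Obj)
    note ge = tgt.Comp_in[OF e[OF XY(1)] g]
    show ?thesis unfolding GA(2)[OF g] tgt.Comp_assoc[OF ge e'[OF XY(2)] e[OF XY(2)]] ee'[OF XY(2)]
      using tgt.Idt_Comp[OF ge] .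
  qed
  have e_cancel: "a = b" if a: "a \<in> Hom D W (OMap F (GO Y))" and b: "b \<in> Hom D W (OMap F (GO Y))"
    and Y: "Y \<in> Obj D" and eq: "Comp D (e Y) a = Comp D (e Y) b" for a b W Y
  proof -
    have "Comp D (e' Y) (Comp D (e Y) c) = c" if "c \<in> Hom D W (OMap F (GO Y))" for c
      using tgt.Comp_assoc[OF that e[OF Y] e'[OF Y]] tgt.Idt_Comp[OF that] e'e[OF Y] by simp
    from this[OF a] this[OF b] eq show ?thesis by metis
  qed
  define G where "G = \<lparr>OMap = GO, AMap = GA\<rparr>"
  have G: "is_functor D C G"
  proof (rule is_functorI)
    fix X assume X: "X \<in> Obj D"
    note i = tgt.Idt_in[OF X] and j = src.Idt_in[OF GO[OF X]]
    have "Comp D (e X) (AMap F (GA (Idt D X))) = Comp D (e X) (Idt D (OMap F (GO X)))"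
      using e_GA[OF i] tgt.Idt_Comp[OF e[OF X]] tgt.Comp_Idt[OF e[OF X]] by simp
    from e_cancel[OF AMap_in[OF GA(1)[OF i]] tgt.Idt_in[OF OMap_in[OF GO[OF X]]] X this]
    show "AMap G (Idt D X) = Idt C (OMap G X)"
      using faithful[OF GA(1)[OF i] j] by (simp add: G_def AMap_Idt GO X)
  next
    fix f g X Y Z assume f: "f \<in> Hom D X Y" and g: "g \<in> Hom D Y Z"
    have XYZ: "X \<in> Obj D" "Y \<in> Obj D" "Z \<in> Obj D" using f g by (auto simp: tgt.Hom_Obj)
    note gf = tgt.Comp_in[OF f g]
    note Ff = AMap_in[OF GA(1)[OF f]] and Fg = AMap_in[OF GA(1)[OF g]]
    have "Comp D (e Z) (AMap F (GA (Comp D g f))) = Comp D (Comp D g f) (e X)" by (rule e_GA[OF gf])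
    also have "\<dots> = Comp D g (Comp D (e Y) (AMap F (GA f)))"
      using tgt.Comp_assoc[OF e[OF XYZ(1)] f g] e_GA[OF f] by simp
    also have "\<dots> = Comp D (Comp D (e Z) (AMap F (GA g))) (AMap F (GA f))"
      using tgt.Comp_assoc[OF Ff e[OF XYZ(2)] g] e_GA[OF g] by simp
    also have "\<dots> = Comp D (e Z) (Comp D (AMap F (GA g)) (AMap F (GA f)))"
      using tgt.Comp_assoc[OF Ff Fg e[OF XYZ(3)]] by simp
    finally have "AMap F (GA (Comp D g f)) = Comp D (AMap F (GA g)) (AMap F (GA f))"
      by (rule e_cancel[OF AMap_in[OF GA(1)[OF gf]] tgt.Comp_in[OF Ff Fg] XYZ(3)])
    then show "AMap G (Comp D g f) = Comp C (AMap G g) (AMap G f)"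
      using faithful[OF GA(1)[OF gf] src.Comp_in[OF GA(1)[OF f] GA(1)[OF g]]]
        AMap_Comp[OF GA(1)[OF f] GA(1)[OF g]] by (simp add: G_def)
  qed (auto simp: G_def GO GA(1) src.category_axioms tgt.category_axioms)
  have eps: "natural_iso D D (comp_ftr F G) id_ftr e"
  proof (intro natural_iso.intro natural_iso_axioms.intro)
    show "is_functor D D (comp_ftr F G)" by (rule is_functor_comp[OF G is_functor_axioms])
    show "is_functor D D id_ftr" by (rule is_functor_id[OF tgt.category_axioms])
    show "e X \<in> Hom D (OMap (comp_ftr F G) X) (OMap id_ftr X)" if "X \<in> Obj D" for X
      using e[OF that] by (simp add: comp_ftr_def id_ftr_def G_def)
    show "Comp D (e Y) (AMap (comp_ftr F G) f) = Comp D (AMap id_ftr f) (e X)"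
      if "f \<in> Hom D X Y" for f X Y
      using e_GA[OF that] by (simp add: comp_ftr_def id_ftr_def G_def)
    show "iso_arr D (e X)" if "X \<in> Obj D" for X
      using tgt.iso_arrI[OF e e' e'e ee'] that by blast
  qed
  \<comment> \<open>The unit at \<open>X\<close> is a lift of the inverse of \<open>e\<close> at
    \<open>OMap F X\<close>; lifting \<open>e\<close> as well supplies its inverse \<theta>.\<close>
  have "\<forall>X\<in>Obj C. \<exists>h k. h \<in> Hom C X (GO (OMap F X)) \<and> AMap F h = e' (OMap F X) \<and>
      k \<in> Hom C (GO (OMap F X)) X \<and> AMap F k = e (OMap F X)"
    using full e e' GO OMap_in by meson
  then obtain \<eta> \<theta> where h: "\<And>X. X \<in> Obj C \<Longrightarrow> \<eta> X \<in> Hom C X (GO (OMap F X))"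
      "\<And>X. X \<in> Obj C \<Longrightarrow> AMap F (\<eta> X) = e' (OMap F X)"
    and k: "\<And>X. X \<in> Obj C \<Longrightarrow> \<theta> X \<in> Hom C (GO (OMap F X)) X"
      "\<And>X. X \<in> Obj C \<Longrightarrow> AMap F (\<theta> X) = e (OMap F X)"
    by metis
  have "natural_iso C C id_ftr (comp_ftr G F) \<eta>"
  proof (intro natural_iso.intro natural_iso_axioms.intro)
    show "is_functor C C id_ftr" by (rule is_functor_id[OF src.category_axioms])
    show "is_functor C C (comp_ftr G F)" by (rule is_functor_comp[OF is_functor_axioms G])
    show "\<eta> X \<in> Hom C (OMap id_ftr X) (OMap (comp_ftr G F) X)" if "X \<in> Obj C" for X
      using h[OF that] by (simp add: comp_ftr_def id_ftr_def G_def)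
    show "Comp C (\<eta> Y) (AMap id_ftr f) = Comp C (AMap (comp_ftr G F) f) (\<eta> X)"
      if f: "f \<in> Hom C X Y" for f X Y
    proof -
      have XY: "X \<in> Obj C" "Y \<in> Obj C" using f by (auto simp: src.Hom_Obj)
      note Ff = AMap_in[OF f] and FX = OMap_in[OF XY(1)] and FY = OMap_in[OF XY(2)]
      note hX = h(1)[OF XY(1)] and hY = h(1)[OF XY(2)] and Gf = GA(1)[OF Ff]
      note a = src.Comp_in[OF f hY] and b = src.Comp_in[OF hX Gf]
      have "Comp D (e (OMap F Y)) (AMap F (Comp C (\<eta> Y) f)) = AMap F f"
        using AMap_Comp[OF f hY] h(2)[OF XY(2)] tgt.Comp_assoc[OF Ff e'[OF FY] e[OF FY]]
          ee'[OF FY] tgt.Idt_Comp[OF Ff] by simp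
      moreover have "Comp D (e (OMap F Y)) (AMap F (Comp C (GA (AMap F f)) (\<eta> X))) = AMap F f"
        using AMap_Comp[OF hX Gf] h(2)[OF XY(1)] e_GA[OF Ff]
          tgt.Comp_assoc[OF e'[OF FX] AMap_in[OF Gf] e[OF FY]]
          tgt.Comp_assoc[OF e'[OF FX] e[OF FX] Ff] ee'[OF FX] tgt.Comp_Idt[OF Ff] by simp
      ultimately have "Comp C (\<eta> Y) f = Comp C (GA (AMap F f)) (\<eta> X)"
        using faithful[OF a b] e_cancel[OF AMap_in[OF a] AMap_in[OF b] FY] by simp
      then show ?thesis by (simp add: comp_ftr_def id_ftr_def G_def)
    qed
    show "iso_arr C (\<eta> X)" if X: "X \<in> Obj C" for X
    proof (rule src.iso_arrI[OF h(1)[OF X] k(1)[OF X]])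
      note hX = h(1)[OF X] and kX = k(1)[OF X] and FX = OMap_in[OF X]
      show "Comp C (\<theta> X) (\<eta> X) = Idt C X"
        using faithful[OF src.Comp_in[OF hX kX] src.Idt_in[OF X]] AMap_Comp[OF hX kX]
          h(2)[OF X] k(2)[OF X] ee'[OF FX] AMap_Idt[OF X] by simp
      show "Comp C (\<eta> X) (\<theta> X) = Idt C (GO (OMap F X))"
        using faithful[OF src.Comp_in[OF kX hX] src.Idt_in[OF GO[OF FX]]] AMap_Comp[OF kX hX]
          h(2)[OF X] k(2)[OF X] e'e[OF FX] AMap_Idt[OF GO[OF FX]] by simp
    qed
  qed
  with G eps show ?thesis unfolding equivalence_of_categories_def
    using is_functor_axioms by blast
qed


section \<open>Stratifications\<close>

text \<open>The level conditions of the factorization axiom in local form, free of indices and of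
  the reversed order, so that they split along lists and make sense for the empty list.\<close>

definition unit_steps :: "('o, 'a) cat \<Rightarrow> ('o \<Rightarrow> nat) \<Rightarrow> 'a list \<Rightarrow> bool" where
  "unit_steps C L gs \<longleftrightarrow> (\<forall>g\<in>set gs. L (Dom C g) = Suc (L (Cod C g)))"

lemma unit_steps_simps [simp]:
  "unit_steps C L []"
  "unit_steps C L (g # gs) \<longleftrightarrow> L (Dom C g) = Suc (L (Cod C g)) \<and> unit_steps C L gs"
  by (auto simp: unit_steps_def)

text \<open>Local drops amount to absolute levels once the total drop is fixed: the codomain of the
  arrow at index \<open>i\<close> still has \<open>length gs - Suc i\<close> unit arrows ahead of
  it.\<close>

lemma unit_steps_iff:
  "path C X gs Y \<Longrightarrow> unit_steps C L gs \<longleftrightarrow> L X = L Y + length gs \<and>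
    (\<forall>i<length gs. L (Cod C (gs ! i)) = L Y + (length gs - Suc i))"
proof (induction gs arbitrary: X)
  case (Cons g gs)
  then have "unit_steps C L gs \<longleftrightarrow> L (Cod C g) = L Y + length gs \<and>
    (\<forall>i<length gs. L (Cod C (gs ! i)) = L Y + (length gs - Suc i))" by simp
  with Cons.prems show ?case by (auto simp: All_less_Suc2)
qed auto

lemma unit_steps_length: "path C X gs Y \<Longrightarrow> unit_steps C L gs \<Longrightarrow> L X = L Y + length gs"
  by (simp add: unit_steps_iff)

text \<open>The axiom counts levels upward from the target, lists count arrows from the source; the
  two conventions are exchanged by the involution \<open>i \<mapsto> m - i\<close> on
  \<open>{0..m}\<close>.\<close>

lemma unit_steps_factorization_iff:
  assumes "path C X gs Y" "L X = n + m + 1" "L Y = n"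
  shows "length gs = m + 1 \<and> (\<forall>i\<le>m. L (Cod C (gs ! (m - i))) = n + i) \<longleftrightarrow> unit_steps C L gs"
proof -
  have "(\<forall>i\<le>m. L (Cod C (gs ! (m - i))) = n + i) \<longleftrightarrow>
      (\<forall>i<m + 1. L (Cod C (gs ! i)) = n + (m + 1 - Suc i))" (is "?l \<longleftrightarrow> ?r")
  proof
    assume l: ?l
    show ?r
    proof (intro allI impI)
      fix i assume "i < m + 1"
      then show "L (Cod C (gs ! i)) = n + (m + 1 - Suc i)" using l[rule_format, of "m - i"] by simp
    qed
  next
    assume r: ?r
    show ?l
    proof (intro allI impI)
      fix i assume "i \<le> m"
      then show "L (Cod C (gs ! (m - i))) = n + i" using r[rule_format, of "m - i"] by simp
    qed
  qed
  then show ?thesis using assms(2,3) by (auto simp: unit_steps_iff[OF assms(1)])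
qed

text \<open>Monotonicity and the criterion for identities follow from the factorization: its length
  is the level drop, and the empty list composes to an identity.\<close>

lemma stratificationI:
  assumes "category C" "terminal C t" and zero: "\<And>X. X \<in> Obj C \<Longrightarrow> L X = 0 \<longleftrightarrow> X = t"
    and ex1: "\<And>f X Y. f \<in> Hom C X Y \<Longrightarrow>
      \<exists>!gs. path C X gs Y \<and> composite C X gs = f \<and> unit_steps C L gs"
  shows "stratification C t L"
proof -
  interpret category C by fact
  show ?thesis
  proof unfold_locales
    fix f X Y assume f: "f \<in> Hom C X Y"
    from ex1[OF f] obtain gs where gs: "path C X gs Y" "composite C X gs = f" "unit_steps C L gs"
      by blast
    note len = unit_steps_length[where L = L, OF gs(1) gs(3)]
    show "L X \<ge> L Y" using len by simp
    show "L X = L Y \<longleftrightarrow> X = Y \<and> f = Idt C X" using len gs by auto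
  next
    fix f X Y n m assume f: "f \<in> Hom C X Y" and L: "L X = n + m + 1" "L Y = n"
    have "(length gs = m + 1 \<and> path C X gs Y \<and> composite C X gs = f \<and>
        (\<forall>i\<le>m. L (Cod C (gs ! (m - i))) = n + i)) \<longleftrightarrow>
        (path C X gs Y \<and> composite C X gs = f \<and> unit_steps C L gs)" for gs
      using unit_steps_factorization_iff[of C X gs Y L, OF _ L] by blast
    then show "\<exists>!gs. length gs = m + 1 \<and> path C X gs Y \<and> composite C X gs = f \<and>
        (\<forall>i\<le>m. L (Cod C (gs ! (m - i))) = n + i)"
      using ex1[OF f] by presburger
  qed (use assms in auto)
qed

context stratification begin

text \<open>Extends the axiom to arrows that preserve the level: these are identities, and a list of
  unit arrows between equal levels is empty.\<close>

lemma unit_factorization: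
  assumes f: "f \<in> Hom C X Y"
  shows "\<exists>!gs. path C X gs Y \<and> composite C X gs = f \<and> unit_steps C L gs"
proof (cases "L X = L Y")
  case True
  then have "X = Y" "f = Idt C X" using eq_iff[OF f] by auto
  moreover have "gs = []" if "path C X gs Y" "unit_steps C L gs" for gs
    using unit_steps_length[OF that] True by simp
  ultimately show ?thesis using Hom_Obj[OF f] by (intro ex1I[of _ "[]"]) auto
next
  case False
  then obtain m where m: "L X = L Y + m + 1" using mono[OF f] less_imp_Suc_add[of "L Y" "L X"] by auto
  have "(length gs = m + 1 \<and> path C X gs Y \<and> composite C X gs = f \<and>
      (\<forall>i\<le>m. L (Cod C (gs ! (m - i))) = L Y + i)) \<longleftrightarrow>
      (path C X gs Y \<and> composite C X gs = f \<and> unit_steps C L gs)" for gs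
    using unit_steps_factorization_iff[of C X gs Y L, OF _ m refl] by blast
  then show ?thesis using factorization[OF f m refl] by presburger
qed

text \<open>By \<open>mono\<close> and \<open>eq_iff\<close> each non-identity lowers the level. As
  unit drops are not assumed, the bound applies to lists that are unit steps for a different
  stratification.\<close>

lemma nonidentity_path_length:
  "path C X gs Y \<Longrightarrow> (\<And>g. g \<in> set gs \<Longrightarrow> Dom C g \<noteq> Cod C g \<or> g \<noteq> Idt C (Dom C g)) \<Longrightarrow>
    L X \<ge> L Y + length gs"
proof (induction gs arbitrary: X)
  case (Cons g gs)
  then have g: "g \<in> Hom C X (Cod C g)" by (auto intro: HomI)
  have "L X \<noteq> L (Cod C g)" using eq_iff[OF g] Cons.prems by auto
  moreover have "L (Cod C g) \<ge> L Y + length gs" using Cons by auto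
  ultimately show ?case using mono[OF g] by simp
qed simp

lemma level_terminal: "L t = 0"
  using zero_iff terminal by (auto simp: terminal_def)

text \<open>The arrow to \<open>t\<close> factors into \<open>L X\<close> unit arrows for
  \<open>L\<close>. These are non-identities, so each of them costs at least one level of
  \<open>M\<close>. By symmetry the levels agree.\<close>

lemma level_le:
  assumes "stratification C t M" and X: "X \<in> Obj C"
  shows "L X \<le> M X"
proof -
  interpret M: stratification C t M by fact
  obtain f where "f \<in> Hom C X t" using terminal X by (auto simp: terminal_def)
  then obtain gs where gs: "path C X gs t" "unit_steps C L gs" using unit_factorization by blast
  have "Dom C g \<noteq> Cod C g" if "g \<in> set gs" for g using that gs(2) by (auto simp: unit_steps_def)
  then have "M X \<ge> length gs" using M.nonidentity_path_length[OF gs(1)] by auto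
  then show ?thesis using unit_steps_length[OF gs] level_terminal by simp
qed

lemma level_unique: "stratification C t M \<Longrightarrow> X \<in> Obj C \<Longrightarrow> L X = M X"
  using level_le[of M X] stratification.level_le[of C t M L X] stratification_axioms by simp

section \<open>The unit arrow out of an object of positive level\<close>

definition proj :: "'o \<Rightarrow> 'a" where
  "proj X = (THE g. g \<in> Arr C \<and> Dom C g = X \<and> L X = Suc (L (Cod C g)))"

text \<open>It is the first member of the unit factorization of the arrow to the terminal object;
  uniqueness of that factorization makes it the only unit arrow out of \<open>X\<close>.\<close>

lemma ex1_unit_arr:
  assumes X: "X \<in> Obj C" "L X > 0"
  shows "\<exists>!g. g \<in> Arr C \<and> Dom C g = X \<and> L X = Suc (L (Cod C g))"
proof -
  obtain f where f: "f \<in> Hom C X t" using terminal X by (auto simp: terminal_def)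
  then obtain gs where gs: "path C X gs t" "composite C X gs = f" "unit_steps C L gs"
    and gs1: "\<And>hs. path C X hs t \<Longrightarrow> composite C X hs = f \<Longrightarrow> unit_steps C L hs \<Longrightarrow> hs = gs"
    using unit_factorization[OF f] by blast
  from X unit_steps_length[OF gs(1,3)] level_terminal obtain g gs' where g: "gs = g # gs'"
    by (cases gs) auto
  show ?thesis
  proof (rule ex1I[of _ g])
    show "g \<in> Arr C \<and> Dom C g = X \<and> L X = Suc (L (Cod C g))" using gs(1,3) g by auto
    fix h assume h: "h \<in> Arr C \<and> Dom C h = X \<and> L X = Suc (L (Cod C h))"
    then have hX: "h \<in> Hom C X (Cod C h)" by (auto intro: HomI)
    obtain k where k: "k \<in> Hom C (Cod C h) t"
      using terminal Hom_Obj(2)[OF hX] by (auto simp: terminal_def)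
    then obtain hs where hs: "path C (Cod C h) hs t" "composite C (Cod C h) hs = k"
      "unit_steps C L hs" using unit_factorization[OF k] by blast
    \<comment> \<open>Prefixing \<open>h\<close> to a unit factorization of the arrow from its
      codomain to \<open>t\<close> gives another unit factorization of the arrow from
      \<open>X\<close> to \<open>t\<close>, hence the same list.\<close>
    have p: "path C X (h # hs) t" using h hs(1) X by simp
    have "h # hs = gs"
      using p h hs(3) by (intro gs1 terminal_arr_unique[OF terminal X(1) composite_in[OF p] f]) auto
    then show "h = g" using g by simp
  qed
qed

lemma proj_in: "X \<in> Obj C \<Longrightarrow> L X > 0 \<Longrightarrow> proj X \<in> Hom C X (Cod C (proj X))"
  using theI'[OF ex1_unit_arr] by (intro HomI) (auto simp: proj_def)

lemma level_Cod_proj: "X \<in> Obj C \<Longrightarrow> L X > 0 \<Longrightarrow> L X = Suc (L (Cod C (proj X)))"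
  using theI'[OF ex1_unit_arr, of X] by (auto simp: proj_def)

lemma proj_eqI: "g \<in> Hom C X Y \<Longrightarrow> L X = Suc (L Y) \<Longrightarrow> proj X = g"
  unfolding proj_def using ex1_unit_arr[of X] Hom_Obj[of g X Y]
  by (intro the1_equality) (auto simp: HomD)

end


section \<open>Free categories\<close>

locale path_encoding =
  fixes enc :: "'v \<times> 'e list \<times> 'v \<Rightarrow> 'f"
  assumes inj_enc: "inj enc"
begin

lemma inv_enc [simp]: "inv enc (enc x) = x"
  by (simp add: inj_enc)

lemma enc_eq_iff [simp]: "enc x = enc y \<longleftrightarrow> x = y"
  using inj_enc by (auto dest: injD)

abbreviation "Free G \<equiv> free_category enc G"

lemma Free_simps [simp]:
  "Obj (Free G) = Obj G"
  "Dom (Free G) (enc (X, es, Y)) = X"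
  "Cod (Free G) (enc (X, es, Y)) = Y"
  "Idt (Free G) X = enc (X, [], X)"
  "Comp (Free G) (enc (Y', es', Z)) (enc (X, es, Y)) = enc (X, es @ es', Z)"
  by (auto simp: free_category_def)

lemma Arr_Free: "a \<in> Arr (Free G) \<longleftrightarrow> (\<exists>X es Y. a = enc (X, es, Y) \<and> path G X es Y)"
  by (auto simp: free_category_def paths_def)

lemma Hom_Free: "a \<in> Hom (Free G) X Y \<longleftrightarrow> (\<exists>es. a = enc (X, es, Y) \<and> path G X es Y)"
  by (auto simp: Hom_def Arr_Free)

lemma slice_Free: "a \<in> slice (Free G) Y \<longleftrightarrow> (\<exists>X es. a = enc (X, es, Y) \<and> path G X es Y)"
  by (auto simp: slice_def Arr_Free)

lemma category_Free: "category (Free G)"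
  by unfold_locales (auto simp: Hom_Free Arr_Free path_append dest: path_Obj)

end


section \<open>The CE-system of a C-system\<close>

lemma p_graph_simps [simp]:
  "Obj (p_graph S) = Obj (cs_cat S)"
  "\<Gamma> \<in> Arr (p_graph S) \<longleftrightarrow> \<Gamma> \<in> Obj (cs_cat S) \<and> cs_len S \<Gamma> > 0"
  "Dom (p_graph S) \<Gamma> = \<Gamma>"
  "Cod (p_graph S) = cs_ft S"
  by (auto simp: p_graph_def)

declare pb_path.simps(2) [simp del]

text \<open>Projection form of the recursion, which replaces the \<open>case\<close> equation in the
  simplifier and lets the arrow \<open>snd (pb_path S f es)\<close> be named in proofs.\<close>

lemma pb_path_Cons [simp]:
  "pb_path S f (\<Xi> # es) =
    (cs_pb S (snd (pb_path S f es)) \<Xi> # fst (pb_path S f es), cs_q S (snd (pb_path S f es)) \<Xi>)"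
  by (simp add: pb_path.simps(2) split: prod.split)

text \<open>Axiom (d) in terms of lists: the part \<open>es\<close> next to the target is pulled
  back first, and \<open>es'\<close>, which is traversed earlier, is pulled back along the arrow
  this produces.\<close>

lemma pb_path_append:
  "pb_path S f (es' @ es) =
    (fst (pb_path S (snd (pb_path S f es)) es') @ fst (pb_path S f es),
     snd (pb_path S (snd (pb_path S f es)) es'))"
  by (induction es') auto

context c_system begin

abbreviation "P \<equiv> p_graph S"

lemma len_path: "path P X es Y \<Longrightarrow> cs_len S X = cs_len S Y + length es"
proof (induction es arbitrary: X)
  case (Cons \<Xi> es)
  then have "cs_len S (cs_ft S \<Xi>) = cs_len S Y + length es" by auto
  with Cons.prems len_ft[of \<Xi>] show ?case by auto
qed simp

lemma path_p: "path P X es Y \<Longrightarrow> path (cs_cat S) X (map (cs_p S) es) Y"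
proof (induction es arbitrary: X)
  case (Cons \<Xi> es)
  then show ?case using HomD[OF p_in[of \<Xi>]] by auto
qed simp

text \<open>At most one edge leaves each vertex, so a path is determined by its source and its
  length, and \<open>len_path\<close> forces the length.\<close>

lemma path_unique: "path P X es Y \<Longrightarrow> path P X es' Y \<Longrightarrow> es = es'"
proof (induction es arbitrary: X es')
  case Nil
  then show ?case using len_path[of X es' Y] by simp
next
  case (Cons \<Xi> es)
  then show ?case using len_path[of X "\<Xi> # es" Y] len_path[of X es' Y] by (cases es') auto
qed

lemma path_to_one: "X \<in> Obj (cs_cat S) \<Longrightarrow> \<exists>es. path P X es (cs_one S)"
proof (induction "cs_len S X" arbitrary: X)
  case 0
  then show ?case using len_zero by (intro exI[of _ "[]"]) auto
next
  case (Suc n)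
  then obtain es where "path P (cs_ft S X) es (cs_one S)"
    using ft_in[of X] len_ft[of X] by fastforce
  then show ?case using Suc by (intro exI[of _ "X # es"]) auto
qed

text \<open>The recursion keeps only the edges and the projection, so the source of the pulled-back
  path appears as a witness \<open>W\<close>, which is the domain of that projection. Each further
  edge pastes one chosen square of the C-system onto the square of the shorter path.\<close>

lemma pb_path_in:
  assumes "path P X es \<Gamma>" and f: "f \<in> Hom (cs_cat S) \<Delta> \<Gamma>"
  shows "\<exists>W. path P W (fst (pb_path S f es)) \<Delta> \<and> snd (pb_path S f es) \<in> Hom (cs_cat S) W X \<and>
    length (fst (pb_path S f es)) = length es \<and>
    pullback (cs_cat S) (composite (cs_cat S) X (map (cs_p S) es)) f (snd (pb_path S f es))
      (composite (cs_cat S) W (map (cs_p S) (fst (pb_path S f es))))"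
  using assms(1)
proof (induction es arbitrary: X)
  case Nil
  then show ?case using f pullback_Idt[OF f] Hom_Obj[OF f] by auto
next
  case (Cons \<Xi> es)
  let ?g = "snd (pb_path S f es)" and ?es = "fst (pb_path S f es)"
  from Cons.prems have X: "X = \<Xi>" "\<Xi> \<in> Obj (cs_cat S)" "cs_len S \<Xi> > 0"
    and es: "path P (cs_ft S \<Xi>) es \<Gamma>" by auto
  from Cons.IH[OF es] obtain W where W: "path P W ?es \<Delta>"
    and g: "?g \<in> Hom (cs_cat S) W (cs_ft S \<Xi>)" and len: "length ?es = length es"
    and pb: "pullback (cs_cat S) (composite (cs_cat S) (cs_ft S \<Xi>) (map (cs_p S) es)) f ?g
      (composite (cs_cat S) W (map (cs_p S) ?es))" by blast
  note g' = X(2,3) g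
  note pb' = pb_in[OF g'] len_pb[OF g'] and ft = ft_pb[OF g']
  note p = p_in[OF X(2,3)] and p' = p_in[OF pb', unfolded ft]
  have "pullback (cs_cat S)
      (Comp (cs_cat S) (composite (cs_cat S) (cs_ft S \<Xi>) (map (cs_p S) es)) (cs_p S \<Xi>)) f
      (cs_q S ?g \<Xi>) (Comp (cs_cat S) (composite (cs_cat S) W (map (cs_p S) ?es))
        (cs_p S (cs_pb S ?g \<Xi>)))"
    by (rule pullback_paste[OF composite_in[OF path_p[OF es]] f g composite_in[OF path_p[OF W]] pb
        p q_in[OF g'] p' pb_pullback[OF g']])
  moreover have "path P (cs_pb S ?g \<Xi>) (cs_pb S ?g \<Xi> # ?es) \<Delta>" using pb' ft W by simp
  ultimately show ?case using q_in[OF g'] X(1) len HomD(3)[OF p] HomD(3)[OF p']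
    by (intro exI[of _ "cs_pb S ?g \<Xi>"]) simp
qed

lemma pb_path_Idt:
  "path P X es \<Gamma> \<Longrightarrow> pb_path S (Idt (cs_cat S) \<Gamma>) es = (es, Idt (cs_cat S) X)"
  by (induction es arbitrary: X) (auto simp: pb_Idt q_Idt)

lemma pb_path_Comp:
  assumes "path P X es \<Gamma>" and f: "f \<in> Hom (cs_cat S) \<Delta> \<Gamma>" and g: "g \<in> Hom (cs_cat S) E \<Delta>"
  shows "pb_path S (Comp (cs_cat S) f g) es =
    (fst (pb_path S g (fst (pb_path S f es))),
     Comp (cs_cat S) (snd (pb_path S f es)) (snd (pb_path S g (fst (pb_path S f es)))))"
  using assms(1)
proof (induction es arbitrary: X)
  case (Cons \<Xi> es)
  let ?P = "pb_path S f es"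
  from Cons.prems have X: "\<Xi> \<in> Obj (cs_cat S)" "cs_len S \<Xi> > 0"
    and es: "path P (cs_ft S \<Xi>) es \<Gamma>" by auto
  from pb_path_in[OF es f] obtain W where W: "path P W (fst ?P) \<Delta>"
    and h: "snd ?P \<in> Hom (cs_cat S) W (cs_ft S \<Xi>)" by blast
  from pb_path_in[OF W g] obtain V where k: "snd (pb_path S g (fst ?P)) \<in> Hom (cs_cat S) V W"
    by blast
  show ?case using Cons.IH[OF es] pb_Comp[OF X h k] q_Comp[OF X h k] by simp
qed simp

end

section \<open>The free category on the canonical projections as part of a stratified
  CE-system\<close>

locale encoded_c_system = c_system S + path_encoding enc
  for S :: "('o, 'a) csys" and enc :: "'o \<times> 'o list \<times> 'o \<Rightarrow> 'f"
begin

lemma CE_obj_simps [simp]: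
  "ce_F (CE_obj enc S) = Free P"
  "ce_C (CE_obj enc S) = cs_cat S"
  "ce_one (CE_obj enc S) = cs_one S"
  "ce_I (CE_obj enc S) (enc (X, es, Y)) = composite (cs_cat S) X (map (cs_p S) es)"
  "ce_pb (CE_obj enc S) f (enc (X, es, Y)) =
    enc (Dom (cs_cat S) (snd (pb_path S f es)), fst (pb_path S f es), Dom (cs_cat S) f)"
  "ce_pi2 (CE_obj enc S) f (enc (X, es, Y)) = snd (pb_path S f es)"
  by (auto simp: CE_obj_def split: prod.split)

definition edge :: "'o \<Rightarrow> 'f" where
  "edge \<Gamma> = enc (\<Gamma>, [\<Gamma>], cs_ft S \<Gamma>)"

lemma edge_simps [simp]: "Dom (Free P) (edge \<Gamma>) = \<Gamma>" "Cod (Free P) (edge \<Gamma>) = cs_ft S \<Gamma>"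
  by (auto simp: edge_def)

lemma edge_in: "\<Gamma> \<in> Obj (cs_cat S) \<Longrightarrow> cs_len S \<Gamma> > 0 \<Longrightarrow> edge \<Gamma> \<in> Hom (Free P) \<Gamma> (cs_ft S \<Gamma>)"
  by (simp add: edge_def Hom_Free ft_in)

lemma edge_factorization:
  "path P X es Y \<Longrightarrow> path (Free P) X (map edge es) Y \<and>
    composite (Free P) X (map edge es) = enc (X, es, Y) \<and>
    unit_steps (Free P) (cs_len S) (map edge es)"
proof (induction es arbitrary: X)
  case (Cons \<Xi> es)
  then show ?case using HomD(1)[OF edge_in[of \<Xi>]] len_ft[of \<Xi>] by (auto simp: edge_def)
qed simp

text \<open>The level drop along an arrow of the free category is the length of its path, so a drop
  by one leaves a single edge.\<close>

lemma unit_arr_edge: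
  assumes "g \<in> Hom (Free P) X Y" "cs_len S X = Suc (cs_len S Y)"
  shows "g = edge X \<and> Y = cs_ft S X"
proof -
  obtain es where es: "g = enc (X, es, Y)" "path P X es Y" using assms(1) by (auto simp: Hom_Free)
  from len_path[OF es(2)] assms(2) obtain \<Xi> where "es = [\<Xi>]" by (cases es) auto
  then show ?thesis using es by (auto simp: edge_def)
qed

lemma unit_steps_edges:
  "path (Free P) X gs Y \<Longrightarrow> unit_steps (Free P) (cs_len S) gs \<Longrightarrow>
    \<exists>es. gs = map edge es \<and> path P X es Y"
proof (induction gs arbitrary: X)
  case Nil
  then show ?case by (intro exI[of _ "[]"]) auto
next
  case (Cons g gs)
  then have g: "g = edge X" "Cod (Free P) g = cs_ft S X"
    using unit_arr_edge[OF HomI, of g X "Cod (Free P) g"] by auto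
  from Cons obtain es where "gs = map edge es" "path P (Cod (Free P) g) es Y" by auto
  then show ?case using g Cons.prems by (intro exI[of _ "X # es"]) auto
qed

lemma terminal_Free: "terminal (Free P) (cs_one S)"
  unfolding terminal_def Hom_Free using path_to_one path_unique one_in by (auto 0 3)

text \<open>The edges of a path form a unit factorization. Any other one consists of edges too, and
  then spells a path with the same endpoints, hence the same path.\<close>

lemma stratification_Free: "stratification (Free P) (cs_one S) (cs_len S)"
proof (rule stratificationI[OF category_Free terminal_Free])
  fix f X Y assume "f \<in> Hom (Free P) X Y"
  then obtain es where es: "f = enc (X, es, Y)" "path P X es Y" by (auto simp: Hom_Free)
  show "\<exists>!gs. path (Free P) X gs Y \<and> composite (Free P) X gs = f \<and>
      unit_steps (Free P) (cs_len S) gs"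
  proof (rule ex1I[of _ "map edge es"])
    show "path (Free P) X (map edge es) Y \<and> composite (Free P) X (map edge es) = f \<and>
        unit_steps (Free P) (cs_len S) (map edge es)"
      using edge_factorization[OF es(2)] es(1) by simp
    fix gs assume gs: "path (Free P) X gs Y \<and> composite (Free P) X gs = f \<and>
        unit_steps (Free P) (cs_len S) gs"
    then obtain es' where "gs = map edge es'" "path P X es' Y" using unit_steps_edges by blast
    then show "gs = map edge es" using path_unique[OF es(2)] by blast
  qed
qed (simp add: len_zero)

lemma rooted_ce_system_CE_obj: "rooted_ce_system (CE_obj enc S)"
proof (intro rooted_ce_system.intro rooted_ce_system_axioms.intro ce_system.intro)
  show "is_functor (ce_F (CE_obj enc S)) (ce_C (CE_obj enc S)) (ce_I_ftr (CE_obj enc S))"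
  proof (rule is_functorI)
    fix f g X Y Z assume "f \<in> Hom (ce_F (CE_obj enc S)) X Y" "g \<in> Hom (ce_F (CE_obj enc S)) Y Z"
    then show "AMap (ce_I_ftr (CE_obj enc S)) (Comp (ce_F (CE_obj enc S)) g f) =
        Comp (ce_C (CE_obj enc S)) (AMap (ce_I_ftr (CE_obj enc S)) g)
          (AMap (ce_I_ftr (CE_obj enc S)) f)"
      using composite_append[OF path_p path_p] by (auto simp: Hom_Free ce_I_ftr_def)
  qed (auto simp: ce_I_ftr_def category_Free category_axioms Hom_Free composite_in path_p)
  fix f \<Delta> \<Gamma> A assume "f \<in> Hom (ce_C (CE_obj enc S)) \<Delta> \<Gamma>" "A \<in> slice (ce_F (CE_obj enc S)) \<Gamma>"
  then obtain X es where f: "f \<in> Hom (cs_cat S) \<Delta> \<Gamma>" and A: "A = enc (X, es, \<Gamma>)" "path P X es \<Gamma>"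
    by (auto simp: slice_Free)
  from pb_path_in[OF A(2) f] obtain W where W: "path P W (fst (pb_path S f es)) \<Delta>"
    and h: "snd (pb_path S f es) \<in> Hom (cs_cat S) W X"
    and pb: "pullback (cs_cat S) (composite (cs_cat S) X (map (cs_p S) es)) f (snd (pb_path S f es))
      (composite (cs_cat S) W (map (cs_p S) (fst (pb_path S f es))))"
    by blast
  \<comment> \<open>\<open>ce_pb\<close> reads the endpoints of the new path off as domains of
    arrows of the second category, so these domains have to be computed.\<close>
  have D [simp]: "Dom (cs_cat S) f = \<Delta>" "Dom (cs_cat S) (snd (pb_path S f es)) = W"
    using f h by (auto simp: HomD)
  show "ce_pb (CE_obj enc S) f A \<in> slice (ce_F (CE_obj enc S)) \<Delta>"
    using W A by (simp add: slice_Free)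
  show "ce_pi2 (CE_obj enc S) f A \<in> Hom (ce_C (CE_obj enc S))
      (Dom (ce_F (CE_obj enc S)) (ce_pb (CE_obj enc S) f A)) (Dom (ce_F (CE_obj enc S)) A)"
    using h A by simp
  show "pullback (ce_C (CE_obj enc S)) (ce_I (CE_obj enc S) A) f (ce_pi2 (CE_obj enc S) f A)
      (ce_I (CE_obj enc S) (ce_pb (CE_obj enc S) f A))"
    using pb A by simp
  show "ce_pb (CE_obj enc S) (Comp (ce_C (CE_obj enc S)) f g) A =
      ce_pb (CE_obj enc S) g (ce_pb (CE_obj enc S) f A)"
    and "ce_pi2 (CE_obj enc S) (Comp (ce_C (CE_obj enc S)) f g) A =
      Comp (ce_C (CE_obj enc S)) (ce_pi2 (CE_obj enc S) f A)
        (ce_pi2 (CE_obj enc S) g (ce_pb (CE_obj enc S) f A))"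
    if "g \<in> Hom (ce_C (CE_obj enc S)) E \<Delta>" for g E
  proof -
    have g: "g \<in> Hom (cs_cat S) E \<Delta>" using that by simp
    from pb_path_in[OF W g] obtain V
      where V: "snd (pb_path S g (fst (pb_path S f es))) \<in> Hom (cs_cat S) V W" by blast
    \<comment> \<open>Again only the endpoints stored in the encoded path need attention; the edges
      and the projection are settled by \<open>pb_path_Comp\<close>.\<close>
    have "Dom (cs_cat S) (Comp (cs_cat S) f g) = Dom (cs_cat S) g"
      using Comp_in[OF g f] g by (simp add: HomD)
    moreover have "Dom (cs_cat S) (Comp (cs_cat S) (snd (pb_path S f es))
        (snd (pb_path S g (fst (pb_path S f es))))) =
        Dom (cs_cat S) (snd (pb_path S g (fst (pb_path S f es))))"
      using Comp_in[OF V h] V by (simp add: HomD)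
    ultimately show "ce_pb (CE_obj enc S) (Comp (ce_C (CE_obj enc S)) f g) A =
        ce_pb (CE_obj enc S) g (ce_pb (CE_obj enc S) f A)"
      and "ce_pi2 (CE_obj enc S) (Comp (ce_C (CE_obj enc S)) f g) A =
        Comp (ce_C (CE_obj enc S)) (ce_pi2 (CE_obj enc S) f A)
          (ce_pi2 (CE_obj enc S) g (ce_pb (CE_obj enc S) f A))"
      using A pb_path_Comp[OF A(2) f g] by simp_all
  qed
  show "ce_pb (CE_obj enc S) f (Comp (ce_F (CE_obj enc S)) A Q) =
      Comp (ce_F (CE_obj enc S)) (ce_pb (CE_obj enc S) f A)
        (ce_pb (CE_obj enc S) (ce_pi2 (CE_obj enc S) f A) Q)"
    and "ce_pi2 (CE_obj enc S) f (Comp (ce_F (CE_obj enc S)) A Q) =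
      ce_pi2 (CE_obj enc S) (ce_pi2 (CE_obj enc S) f A) Q"
    if "Q \<in> slice (ce_F (CE_obj enc S)) (Dom (ce_F (CE_obj enc S)) A)" for Q
    using that A by (auto simp: slice_Free pb_path_append)
next
  fix f \<Delta> \<Gamma> assume f: "f \<in> Hom (ce_C (CE_obj enc S)) \<Delta> \<Gamma>"
  then have "Dom (cs_cat S) f = \<Delta>" by (simp add: HomD)
  then show "ce_pb (CE_obj enc S) f (Idt (ce_F (CE_obj enc S)) \<Gamma>) = Idt (ce_F (CE_obj enc S)) \<Delta>"
    and "ce_pi2 (CE_obj enc S) f (Idt (ce_F (CE_obj enc S)) \<Gamma>) = f" by simp_all
next
  fix \<Gamma> A assume \<Gamma>: "\<Gamma> \<in> Obj (ce_C (CE_obj enc S))" and "A \<in> slice (ce_F (CE_obj enc S)) \<Gamma>"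
  then obtain X es where A: "A = enc (X, es, \<Gamma>)" "path P X es \<Gamma>" by (auto simp: slice_Free)
  have "Dom (cs_cat S) (Idt (cs_cat S) Y) = Y" if "Y \<in> Obj (cs_cat S)" for Y
    using Idt_in[OF that] by (simp add: HomD)
  then show "ce_pb (CE_obj enc S) (Idt (ce_C (CE_obj enc S)) \<Gamma>) A = A"
    and "ce_pi2 (CE_obj enc S) (Idt (ce_C (CE_obj enc S)) \<Gamma>) A =
      Idt (ce_C (CE_obj enc S)) (Dom (ce_F (CE_obj enc S)) A)"
    using A pb_path_Idt[OF A(2)] path_Obj[OF A(2)] by simp_all
qed (simp_all add: terminal_Free one_terminal)

text \<open>Slice levels are path lengths here, and pulling back a path preserves its
  length.\<close>

lemma stratified_ce_CE_obj: "stratified_ce (CE_obj enc S)"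
  unfolding stratified_ce_def
proof (intro exI[of _ "cs_len S"] conjI allI ballI)
  show "stratification (ce_F (CE_obj enc S)) (ce_one (CE_obj enc S)) (cs_len S)"
    by (simp add: stratification_Free)
  fix \<Delta> \<Gamma> f A assume "f \<in> Hom (ce_C (CE_obj enc S)) \<Delta> \<Gamma>" "A \<in> slice (ce_F (CE_obj enc S)) \<Gamma>"
  then obtain X es where f: "f \<in> Hom (cs_cat S) \<Delta> \<Gamma>" and A: "A = enc (X, es, \<Gamma>)" "path P X es \<Gamma>"
    by (auto simp: slice_Free)
  from pb_path_in[OF A(2) f] obtain W where W: "path P W (fst (pb_path S f es)) \<Delta>"
    "snd (pb_path S f es) \<in> Hom (cs_cat S) W X" "length (fst (pb_path S f es)) = length es" by blast
  then show "slice_level (ce_F (CE_obj enc S)) (cs_len S) A =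
      slice_level (ce_F (CE_obj enc S)) (cs_len S) (ce_pb (CE_obj enc S) f A)"
    using A f len_path[OF A(2)] len_path[OF W(1)] by (simp add: slice_level_def HomD)
qed

end


section \<open>The categories of C-systems and of CE-systems\<close>

lemma (in is_functor) AMap_Arr:
  assumes "f \<in> Arr C"
  shows "AMap F f \<in> Arr D" "Dom D (AMap F f) = OMap F (Dom C f)" "Cod D (AMap F f) = OMap F (Cod C f)"
  using HomD[OF AMap_in[OF Arr_Hom[OF assms]]] by auto

lemma (in is_functor) AMap_slice: "A \<in> slice C X \<Longrightarrow> AMap F A \<in> slice D (OMap F X)"
  using AMap_Arr by (auto simp: slice_def)

lemma comp_ftr_simps [simp]:
  "OMap (comp_ftr G F) X = OMap G (OMap F X)"
  "AMap (comp_ftr G F) f = AMap G (AMap F f)"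
  by (auto simp: comp_ftr_def)

lemma id_ftr_simps [simp]: "OMap id_ftr X = X" "AMap id_ftr f = f"
  by (auto simp: id_ftr_def)

text \<open>Composites in both categories of systems are cut down to the carriers; the identity laws
  hold because morphisms are extensional to begin with.\<close>

lemma restrict_comp_id_right:
  "extensional_ftr C F \<Longrightarrow> restrict_ftr C (comp_ftr F (restrict_ftr C id_ftr)) = F"
  by (rule extensional_ftr_eqI[OF extensional_ftr_restrict]) auto

lemma restrict_comp_id_left:
  assumes "is_functor C D F" "extensional_ftr C F"
  shows "restrict_ftr C (comp_ftr (restrict_ftr D id_ftr) F) = F"
proof -
  interpret is_functor C D F by fact
  show ?thesis
    by (rule extensional_ftr_eqI[OF extensional_ftr_restrict assms(2)])
      (auto simp: OMap_in AMap_Arr)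
qed

text \<open>The inner restrictions are invisible because functors send carriers into
  carriers.\<close>

lemma restrict_comp_assoc:
  assumes "is_functor C D F"
  shows "restrict_ftr C (comp_ftr H (restrict_ftr C (comp_ftr G F))) =
    restrict_ftr C (comp_ftr (restrict_ftr D (comp_ftr H G)) F)"
proof -
  interpret is_functor C D F by fact
  show ?thesis
    by (rule extensional_ftr_eqI[OF extensional_ftr_restrict extensional_ftr_restrict])
      (auto simp: OMap_in AMap_Arr)
qed

section \<open>The category of C-systems\<close>

lemma csys_hom_id:
  assumes "c_system S"
  shows "csys_hom S S (restrict_ftr (cs_cat S) id_ftr)"
proof -
  interpret c_system S by fact
  show ?thesis
  proof (intro csys_hom.intro csys_hom_axioms.intro assms)
    show "is_functor (cs_cat S) (cs_cat S) (restrict_ftr (cs_cat S) id_ftr)"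
      by (rule is_functor_restrict[OF is_functor_id[OF category_axioms]])
  qed (use HomD(1)[OF p_in] HomD(1)[OF q_in] in
        \<open>auto simp: extensional_ftr_restrict one_in ft_in pb_in HomD(1)\<close>)
qed

lemma csys_hom_comp:
  assumes "csys_hom S T F" "csys_hom T U G"
  shows "csys_hom S U (restrict_ftr (cs_cat S) (comp_ftr G F))"
proof -
  interpret F: csys_hom S T F by fact
  interpret G: csys_hom T U G by fact
  show ?thesis
  proof (intro csys_hom.intro csys_hom_axioms.intro F.src.c_system_axioms G.tgt.c_system_axioms)
    show "is_functor (cs_cat S) (cs_cat U) (restrict_ftr (cs_cat S) (comp_ftr G F))"
      by (rule is_functor_restrict[OF is_functor_comp[OF F.is_functor_axioms G.is_functor_axioms]])
  next
    fix \<Gamma> \<Delta> f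
    assume \<Gamma>: "\<Gamma> \<in> Obj (cs_cat S)" "cs_len S \<Gamma> > 0" and f: "f \<in> Hom (cs_cat S) \<Delta> (cs_ft S \<Gamma>)"
    have F\<Gamma>: "OMap F \<Gamma> \<in> Obj (cs_cat T)" "cs_len T (OMap F \<Gamma>) > 0"
      using \<Gamma> by (auto simp: F.OMap_in F.pres_len)
    have Ff: "AMap F f \<in> Hom (cs_cat T) (OMap F \<Delta>) (cs_ft T (OMap F \<Gamma>))"
      using F.AMap_in[OF f] \<Gamma> by (simp add: F.pres_ft)
    show "OMap (restrict_ftr (cs_cat S) (comp_ftr G F)) (cs_pb S f \<Gamma>) =
        cs_pb U (AMap (restrict_ftr (cs_cat S) (comp_ftr G F)) f)
          (OMap (restrict_ftr (cs_cat S) (comp_ftr G F)) \<Gamma>)"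
      using F.pres_pb[OF \<Gamma> f] G.pres_pb[OF F\<Gamma> Ff] \<Gamma> f
      by (simp add: F.src.pb_in[OF \<Gamma> f] HomD(1)[OF f])
    show "AMap (restrict_ftr (cs_cat S) (comp_ftr G F)) (cs_q S f \<Gamma>) =
        cs_q U (AMap (restrict_ftr (cs_cat S) (comp_ftr G F)) f)
          (OMap (restrict_ftr (cs_cat S) (comp_ftr G F)) \<Gamma>)"
      using F.pres_q[OF \<Gamma> f] G.pres_q[OF F\<Gamma> Ff] \<Gamma> f
      by (simp add: HomD(1)[OF F.src.q_in[OF \<Gamma> f]] HomD(1)[OF f])
  qed (use HomD(1)[OF F.src.p_in] in \<open>auto simp: extensional_ftr_restrict F.src.one_in F.src.ft_in
        F.OMap_in F.pres_one F.pres_len F.pres_ft F.pres_p G.pres_one G.pres_len G.pres_ft G.pres_p\<close>)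
qed

lemma Csys_simps [simp]:
  "Obj Csys = {S. c_system S}"
  "Idt Csys S = (S, restrict_ftr (cs_cat S) id_ftr, S)"
  "Comp Csys (T', G, U) (S, F, T) = (S, restrict_ftr (cs_cat S) (comp_ftr G F), U)"
  by (auto simp: Csys_def)

lemma Hom_Csys: "f \<in> Hom Csys S T \<longleftrightarrow> (\<exists>F. f = (S, F, T) \<and> csys_hom S T F)"
  by (auto simp: Hom_def Csys_def)

lemma category_Csys: "category (Csys :: (('o, 'a) csys, ('o, 'a) csys_arr) cat)"
proof
  fix f :: "('o, 'a) csys_arr" assume "f \<in> Arr Csys"
  then show "Dom Csys f \<in> Obj Csys" "Cod Csys f \<in> Obj Csys"
    by (auto simp: Csys_def csys_hom_def)
next
  fix S :: "('o, 'a) csys" assume "S \<in> Obj Csys"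
  then show "Idt Csys S \<in> Hom Csys S S" by (simp add: Hom_Csys csys_hom_id)
next
  fix f g :: "('o, 'a) csys_arr" and S T U
  assume "f \<in> Hom Csys S T" "g \<in> Hom Csys T U"
  then show "Comp Csys g f \<in> Hom Csys S U" by (auto simp: Hom_Csys csys_hom_comp)
next
  fix f :: "('o, 'a) csys_arr" and S T assume "f \<in> Hom Csys S T"
  then obtain F where f: "f = (S, F, T)" and F: "csys_hom S T F" by (auto simp: Hom_Csys)
  interpret csys_hom S T F by fact
  show "Comp Csys f (Idt Csys S) = f" "Comp Csys (Idt Csys T) f = f"
    using f restrict_comp_id_right[OF extensional] restrict_comp_id_left[OF is_functor_axioms extensional]
    by simp_all
next
  fix f g h :: "('o, 'a) csys_arr" and S T U V
  assume "f \<in> Hom Csys S T" "g \<in> Hom Csys T U" "h \<in> Hom Csys U V"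
  then obtain F G H where fgh: "f = (S, F, T)" "g = (T, G, U)" "h = (U, H, V)" and F: "csys_hom S T F"
    by (auto simp: Hom_Csys)
  interpret csys_hom S T F by fact
  show "Comp Csys h (Comp Csys g f) = Comp Csys (Comp Csys h g) f"
    using restrict_comp_assoc[OF is_functor_axioms] by (simp add: fgh)
qed

section \<open>The category of stratified rooted CE-systems\<close>

lemma stratified_functor_id:
  assumes "stratification C t L"
  shows "stratified_functor C t C t (restrict_ftr C id_ftr)"
proof -
  interpret stratification C t L by fact
  show ?thesis unfolding stratified_functor_def
    using is_functor_restrict[OF is_functor_id[OF category_axioms]] assms by auto
qed

text \<open>The two hypotheses provide possibly different level functions \<open>M\<close> and
  \<open>M'\<close> on the middle category; \<open>level_unique\<close> identifies them on
  objects.\<close>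

lemma stratified_functor_comp:
  assumes "stratified_functor C t D u F" "stratified_functor D u E v G"
  shows "stratified_functor C t E v (restrict_ftr C (comp_ftr G F))"
proof -
  from assms obtain L M M' N where F: "is_functor C D F" and G: "is_functor D E G"
    and st: "stratification C t L" "stratification D u M" "stratification D u M'" "stratification E v N"
    and L: "\<And>X. X \<in> Obj C \<Longrightarrow> L X = M (OMap F X)" "\<And>X. X \<in> Obj D \<Longrightarrow> M' X = N (OMap G X)"
    unfolding stratified_functor_def by blast
  interpret F: is_functor C D F by fact
  have "L X = N (OMap (restrict_ftr C (comp_ftr G F)) X)" if "X \<in> Obj C" for X
    using L(1)[OF that] L(2)[OF F.OMap_in[OF that]] that
      stratification.level_unique[OF st(2,3) F.OMap_in[OF that]] by simp
  then show ?thesis unfolding stratified_functor_def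
    using is_functor_restrict[OF is_functor_comp[OF F G]] st(1,4) by blast
qed

lemma (in ce_system) I_in: "A \<in> Hom (ce_F S) X Y \<Longrightarrow> ce_I S A \<in> Hom (ce_C S) X Y"
  using is_functor.AMap_in[OF I_functor] by (simp add: ce_I_ftr_def)

lemma (in ce_system) I_Arr_in: "A \<in> Arr (ce_F S) \<Longrightarrow> ce_I S A \<in> Arr (ce_C S)"
  by (rule HomD(1)[OF I_in[OF Arr_Hom]])

lemma (in ce_system) category_F: "category (ce_F S)"
  using I_functor by (auto simp: is_functor_def)

lemma (in ce_system) category_C: "category (ce_C S)"
  using I_functor by (auto simp: is_functor_def)

lemma ce_hom_id:
  assumes "ce_system S"
  shows "ce_hom S S \<lparr>FF = restrict_ftr (ce_F S) id_ftr, FC = restrict_ftr (ce_C S) id_ftr\<rparr>"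
    (is "ce_hom S S ?H")
proof -
  interpret ce_system S by fact
  show ?thesis
  proof (intro ce_hom.intro ce_hom_axioms.intro assms)
    show "is_functor (ce_F S) (ce_F S) (FF ?H)" "is_functor (ce_C S) (ce_C S) (FC ?H)"
      using is_functor_restrict[OF is_functor_id] category_F category_C by auto
    fix f \<Delta> \<Gamma> A assume fA: "f \<in> Hom (ce_C S) \<Delta> \<Gamma>" "A \<in> slice (ce_F S) \<Gamma>"
    then have Arr: "f \<in> Arr (ce_C S)" "A \<in> Arr (ce_F S)" "ce_pb S f A \<in> Arr (ce_F S)"
      "ce_pi2 S f A \<in> Arr (ce_C S)"
      using pb_in[OF fA] pi2_in[OF fA] by (auto simp: Hom_def slice_def)
    then show "AMap (FF ?H) (ce_pb S f A) = ce_pb S (AMap (FC ?H) f) (AMap (FF ?H) A)"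
      and "AMap (FC ?H) (ce_pi2 S f A) = ce_pi2 S (AMap (FC ?H) f) (AMap (FF ?H) A)" by auto
  next
    show "OMap (FF ?H) (ce_one S) = ce_one S" using one_terminal by (simp add: terminal_def)
  qed (auto simp: extensional_ftr_restrict Obj_eq I_Arr_in)
qed

lemma ce_hom_comp:
  assumes "ce_hom S T H" "ce_hom T U K"
  shows "ce_hom S U \<lparr>FF = restrict_ftr (ce_F S) (comp_ftr (FF K) (FF H)),
    FC = restrict_ftr (ce_C S) (comp_ftr (FC K) (FC H))\<rparr>" (is "ce_hom S U ?N")
proof -
  interpret H: ce_hom S T H by fact
  interpret K: ce_hom T U K by fact
  show ?thesis
  proof (intro ce_hom.intro ce_hom_axioms.intro H.src.ce_system_axioms K.tgt.ce_system_axioms)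
    show "is_functor (ce_F S) (ce_F U) (FF ?N)" "is_functor (ce_C S) (ce_C U) (FC ?N)"
      using is_functor_restrict[OF is_functor_comp] H.F.is_functor_axioms K.F.is_functor_axioms
        H.C.is_functor_axioms K.C.is_functor_axioms by auto
    fix f \<Delta> \<Gamma> A assume fA: "f \<in> Hom (ce_C S) \<Delta> \<Gamma>" "A \<in> slice (ce_F S) \<Gamma>"
    then have Arr: "f \<in> Arr (ce_C S)" "A \<in> Arr (ce_F S)" "ce_pb S f A \<in> Arr (ce_F S)"
      "ce_pi2 S f A \<in> Arr (ce_C S)"
      using H.src.pb_in[OF fA] H.src.pi2_in[OF fA] by (auto simp: Hom_def slice_def)
    have \<Gamma>: "\<Gamma> \<in> Obj (ce_F S)" using H.C.src.Hom_Obj[OF fA(1)] H.src.Obj_eq by simp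
    have fA': "AMap (FC H) f \<in> Hom (ce_C T) (OMap (FC H) \<Delta>) (OMap (FC H) \<Gamma>)"
      "AMap (FF H) A \<in> slice (ce_F T) (OMap (FC H) \<Gamma>)"
      using H.C.AMap_in[OF fA(1)] H.F.AMap_slice[OF fA(2)] H.I_Obj[OF \<Gamma>] by auto
    show "AMap (FF ?N) (ce_pb S f A) = ce_pb U (AMap (FC ?N) f) (AMap (FF ?N) A)"
      and "AMap (FC ?N) (ce_pi2 S f A) = ce_pi2 U (AMap (FC ?N) f) (AMap (FF ?N) A)"
      using Arr H.pres_pb[OF fA] H.pres_pi2[OF fA] K.pres_pb[OF fA'] K.pres_pi2[OF fA'] by simp_all
  next
    fix X assume X: "X \<in> Obj (ce_F S)"
    then show "OMap (FC ?N) X = OMap (FF ?N) X"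
      using H.I_Obj[OF X] K.I_Obj[OF H.F.OMap_in[OF X]] by (simp add: H.src.Obj_eq[symmetric])
  next
    fix A assume A: "A \<in> Arr (ce_F S)"
    then show "AMap (FC ?N) (ce_I S A) = ce_I U (AMap (FF ?N) A)"
      using H.I_Arr[OF A] K.I_Arr[OF H.F.AMap_Arr(1)[OF A]] by (simp add: H.src.I_Arr_in)
  next
    show "OMap (FF ?N) (ce_one S) = ce_one U"
      using H.src.one_terminal by (simp add: terminal_def H.pres_one K.pres_one)
  qed (auto simp: extensional_ftr_restrict)
qed

lemma rCEsys_simps [simp]:
  "Obj rCEsys = {S. rooted_ce_system S \<and> stratified_ce S}"
  "Idt rCEsys S =
    (S, \<lparr>FF = restrict_ftr (ce_F S) id_ftr, FC = restrict_ftr (ce_C S) id_ftr\<rparr>, S)"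
  "Comp rCEsys (T', K, U) (S, H, T) =
    (S, \<lparr>FF = restrict_ftr (ce_F S) (comp_ftr (FF K) (FF H)),
         FC = restrict_ftr (ce_C S) (comp_ftr (FC K) (FC H))\<rparr>, U)"
  by (auto simp: rCEsys_def)

lemma Hom_rCEsys: "f \<in> Hom rCEsys S T \<longleftrightarrow>
    S \<in> Obj rCEsys \<and> T \<in> Obj rCEsys \<and> (\<exists>H. f = (S, H, T) \<and> stratified_ce_hom S T H)"
  by (auto simp: Hom_def rCEsys_def)

lemma category_rCEsys: "category (rCEsys :: (('o, 'f, 'a) cesys, ('o, 'f, 'a) ce_arr) cat)"
proof
  fix f :: "('o, 'f, 'a) ce_arr" assume "f \<in> Arr rCEsys"
  then show "Dom rCEsys f \<in> Obj rCEsys" "Cod rCEsys f \<in> Obj rCEsys"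
    by (auto simp: rCEsys_def)
next
  fix S :: "('o, 'f, 'a) cesys" assume "S \<in> Obj rCEsys"
  then show "Idt rCEsys S \<in> Hom rCEsys S S"
    using ce_hom_id[of S] stratified_functor_id
    by (auto simp: Hom_rCEsys stratified_ce_hom_def stratified_ce_def rooted_ce_system_def)
next
  fix f g :: "('o, 'f, 'a) ce_arr" and S T U
  assume "f \<in> Hom rCEsys S T" "g \<in> Hom rCEsys T U"
  then show "Comp rCEsys g f \<in> Hom rCEsys S U"
    using ce_hom_comp[of S T _ U] stratified_functor_comp
    by (fastforce simp: Hom_rCEsys stratified_ce_hom_def)
next
  fix f :: "('o, 'f, 'a) ce_arr" and S T assume "f \<in> Hom rCEsys S T"
  then obtain H where f: "f = (S, H, T)" and "ce_hom S T H"
    by (auto simp: Hom_rCEsys stratified_ce_hom_def)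
  interpret ce_hom S T H by fact
  show "Comp rCEsys f (Idt rCEsys S) = f" "Comp rCEsys (Idt rCEsys T) f = f"
    using f restrict_comp_id_right[OF extensional_F] restrict_comp_id_right[OF extensional_C]
      restrict_comp_id_left[OF F.is_functor_axioms extensional_F]
      restrict_comp_id_left[OF C.is_functor_axioms extensional_C]
    by simp_all
next
  fix f g h :: "('o, 'f, 'a) ce_arr" and S T U V
  assume "f \<in> Hom rCEsys S T" "g \<in> Hom rCEsys T U" "h \<in> Hom rCEsys U V"
  then obtain H K M where fgh: "f = (S, H, T)" "g = (T, K, U)" "h = (U, M, V)" and "ce_hom S T H"
    by (auto simp: Hom_rCEsys stratified_ce_hom_def)
  interpret ce_hom S T H by fact
  show "Comp rCEsys h (Comp rCEsys g f) = Comp rCEsys (Comp rCEsys h g) f"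
    by (simp add: fgh restrict_comp_assoc[OF F.is_functor_axioms]
        restrict_comp_assoc[OF C.is_functor_axioms])
qed


section \<open>The functor from C-systems to CE-systems\<close>

locale encoded_csys_hom = csys_hom S T F + path_encoding enc
  for S T :: "('o, 'a) csys" and F and enc :: "'o \<times> 'o list \<times> 'o \<Rightarrow> 'f"
begin

sublocale src: encoded_c_system S enc ..
sublocale tgt: encoded_c_system T enc ..

lemma path_OMap:
  "path (p_graph S) X es Y \<Longrightarrow> path (p_graph T) (OMap F X) (map (OMap F) es) (OMap F Y)"
proof (induction es arbitrary: X)
  case (Cons \<Xi> es)
  then show ?case by (auto simp: OMap_in pres_len pres_ft[symmetric])
qed (auto simp: OMap_in)

lemma free_map_simps [simp]:
  "X \<in> Obj (cs_cat S) \<Longrightarrow> OMap (free_map enc S F) X = OMap F X"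
  "path (p_graph S) X es Y \<Longrightarrow>
    AMap (free_map enc S F) (enc (X, es, Y)) = enc (OMap F X, map (OMap F) es, OMap F Y)"
  by (auto simp: free_map_def Arr_Free)

lemma free_map_path_Obj [simp]:
  "path (p_graph S) X es Y \<Longrightarrow> OMap (free_map enc S F) X = OMap F X"
  "path (p_graph S) X es Y \<Longrightarrow> OMap (free_map enc S F) Y = OMap F Y"
  using path_Obj[of "p_graph S" X es Y] by auto

text \<open>Both components go through the induction together: the image of the projection for the
  tail is the arrow along which the next edge is pulled back.\<close>

lemma pb_path_OMap:
  assumes "path (p_graph S) X es \<Gamma>" and f: "f \<in> Hom (cs_cat S) \<Delta> \<Gamma>"
  shows "pb_path T (AMap F f) (map (OMap F) es) =
    (map (OMap F) (fst (pb_path S f es)), AMap F (snd (pb_path S f es)))"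
  using assms(1)
proof (induction es arbitrary: X)
  case (Cons \<Xi> es)
  then have \<Xi>: "\<Xi> \<in> Obj (cs_cat S)" "cs_len S \<Xi> > 0" and es: "path (p_graph S) (cs_ft S \<Xi>) es \<Gamma>"
    by auto
  from src.pb_path_in[OF es f] obtain W
    where "snd (pb_path S f es) \<in> Hom (cs_cat S) W (cs_ft S \<Xi>)" by blast
  note g = \<Xi> this
  show ?case using Cons.IH[OF es] pres_pb[OF g] pres_q[OF g] by simp
qed simp

lemma stratified_ce_hom_CE:
  "stratified_ce_hom (CE_obj enc S) (CE_obj enc T) \<lparr>FF = free_map enc S F, FC = F\<rparr>"
    (is "stratified_ce_hom _ _ ?H")
proof -
  have FF: "is_functor (Free (p_graph S)) (Free (p_graph T)) (free_map enc S F)"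
  proof (rule is_functorI)
    fix a b X Y Z assume "a \<in> Hom (Free (p_graph S)) X Y" "b \<in> Hom (Free (p_graph S)) Y Z"
    then obtain es es' where "a = enc (X, es, Y)" "b = enc (Y, es', Z)"
      and *: "path (p_graph S) X es Y" "path (p_graph S) Y es' Z" by (auto simp: Hom_Free)
    moreover from * have "path (p_graph S) X (es @ es') Z" by (auto simp: path_append)
    ultimately show "AMap (free_map enc S F) (Comp (Free (p_graph S)) b a) =
        Comp (Free (p_graph T)) (AMap (free_map enc S F) b) (AMap (free_map enc S F) a)" by simp
  qed (auto simp: category_Free Hom_Free OMap_in path_OMap)
  have "ce_hom (CE_obj enc S) (CE_obj enc T) ?H"
  proof (intro ce_hom.intro ce_hom_axioms.intro)
    show "ce_system (CE_obj enc S)" "ce_system (CE_obj enc T)"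
      using src.rooted_ce_system_CE_obj tgt.rooted_ce_system_CE_obj
      by (auto simp: rooted_ce_system_def)
    show "is_functor (ce_F (CE_obj enc S)) (ce_F (CE_obj enc T)) (FF ?H)"
      using FF by simp
    show "is_functor (ce_C (CE_obj enc S)) (ce_C (CE_obj enc T)) (FC ?H)"
      using is_functor_axioms by simp
    show "extensional_ftr (ce_F (CE_obj enc S)) (FF ?H)"
      by (simp add: free_map_def extensional_ftr_restrict)
    show "extensional_ftr (ce_C (CE_obj enc S)) (FC ?H)" by (simp add: extensional)
    show "OMap (FF ?H) (ce_one (CE_obj enc S)) = ce_one (CE_obj enc T)"
      by (simp add: pres_one src.one_in)
    show "OMap (FC ?H) X = OMap (FF ?H) X" if "X \<in> Obj (ce_F (CE_obj enc S))" for X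
      using that by simp
    show "AMap (FC ?H) (ce_I (CE_obj enc S) A) = ce_I (CE_obj enc T) (AMap (FF ?H) A)"
      if "A \<in> Arr (ce_F (CE_obj enc S))" for A
    proof -
      from that obtain X es Y where A: "A = enc (X, es, Y)" "path (p_graph S) X es Y"
        by (auto simp: Arr_Free)
      \<comment> \<open>Every edge of a path has positive length, so \<open>pres_p\<close> applies
        edge by edge.\<close>
      have "map (AMap F) (map (cs_p S) es) = map (cs_p T) (map (OMap F) es)"
        using A(2)
      proof (induction es arbitrary: X)
        case (Cons \<Xi> es)
        then show ?case by (auto simp: pres_p)
      qed simp
      then show ?thesis using A AMap_composite[OF src.path_p[OF A(2)]] by (simp cong: map_cong)
    qed
    fix f \<Delta> \<Gamma> A assume "f \<in> Hom (ce_C (CE_obj enc S)) \<Delta> \<Gamma>" "A \<in> slice (ce_F (CE_obj enc S)) \<Gamma>"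
    then obtain X es where f: "f \<in> Hom (cs_cat S) \<Delta> \<Gamma>" and A: "A = enc (X, es, \<Gamma>)"
      "path (p_graph S) X es \<Gamma>" by (auto simp: slice_Free)
    from src.pb_path_in[OF A(2) f] obtain W where W: "path (p_graph S) W (fst (pb_path S f es)) \<Delta>"
      and h: "snd (pb_path S f es) \<in> Hom (cs_cat S) W X" by blast
    show "AMap (FF ?H) (ce_pb (CE_obj enc S) f A) =
        ce_pb (CE_obj enc T) (AMap (FC ?H) f) (AMap (FF ?H) A)"
      using A W HomD(2)[OF AMap_in[OF h]] HomD(2)[OF h] HomD(2)[OF AMap_in[OF f]] HomD(2)[OF f]
      by (simp add: pb_path_OMap[OF A(2) f])
    show "AMap (FC ?H) (ce_pi2 (CE_obj enc S) f A) =
        ce_pi2 (CE_obj enc T) (AMap (FC ?H) f) (AMap (FF ?H) A)"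
      using A by (simp add: pb_path_OMap[OF A(2) f])
  qed
  moreover have "stratified_functor (Free (p_graph S)) (cs_one S) (Free (p_graph T)) (cs_one T)
      (free_map enc S F)"
    unfolding stratified_functor_def using FF src.stratification_Free tgt.stratification_Free
    by (intro conjI exI[of _ "cs_len S"] exI[of _ "cs_len T"]) (auto simp: pres_len)
  ultimately show ?thesis by (simp add: stratified_ce_hom_def)
qed

end

lemma is_functor_CE:
  assumes "inj (enc :: 'o \<times> 'o list \<times> 'o \<Rightarrow> 'f)"
  shows "is_functor (Csys :: (('o, 'a) csys, ('o, 'a) csys_arr) cat)
    (rCEsys :: (('o, 'f, 'a) cesys, ('o, 'f, 'a) ce_arr) cat) (CE enc)"
proof (rule is_functorI[OF category_Csys category_rCEsys])
  interpret path_encoding enc using assms by unfold_locales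
  have enc_sys: "encoded_c_system S enc" if "c_system S" for S :: "('o, 'a) csys"
    using that path_encoding_axioms by (simp add: encoded_c_system_def)
  have enc_hom: "encoded_csys_hom S T F enc" if "csys_hom S T F" for S T :: "('o, 'a) csys" and F
    using that path_encoding_axioms by (simp add: encoded_csys_hom_def)
  show obj: "OMap (CE enc) S \<in> Obj rCEsys" if "S \<in> Obj Csys" for S :: "('o, 'a) csys"
    using encoded_c_system.rooted_ce_system_CE_obj[OF enc_sys]
      encoded_c_system.stratified_ce_CE_obj[OF enc_sys] that by (auto simp: CE_def)
  show "AMap (CE enc) f \<in> Hom rCEsys (OMap (CE enc) S) (OMap (CE enc) T)"
    if f: "f \<in> Hom Csys S T" for f :: "('o, 'a) csys_arr" and S T
  proof -
    from f obtain F where F: "f = (S, F, T)" "csys_hom S T F" by (auto simp: Hom_Csys)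
    then have ST: "S \<in> Obj Csys" "T \<in> Obj Csys" by (auto simp: csys_hom_def)
    then show ?thesis
      using encoded_csys_hom.stratified_ce_hom_CE[OF enc_hom[OF F(2)]] obj F
      by (auto simp: Hom_rCEsys CE_def)
  qed
  show "AMap (CE enc) (Idt Csys S) = Idt rCEsys (OMap (CE enc) S)"
    if "S \<in> Obj Csys" for S :: "('o, 'a) csys"
  proof -
    from that have S: "c_system S" by simp
    interpret encoded_csys_hom S S "restrict_ftr (cs_cat S) id_ftr" enc
      by (rule enc_hom[OF csys_hom_id[OF S]])
    have "map (OMap (restrict_ftr (cs_cat S) id_ftr)) es = es" if "path (p_graph S) X es Y" for X es Y
      using that by (induction es arbitrary: X) auto
    moreover have "X \<in> Obj (cs_cat S) \<and> Y \<in> Obj (cs_cat S)" if "path (p_graph S) X es Y" for X es Y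
      using path_Obj[OF that] by simp
    ultimately have "free_map enc S (restrict_ftr (cs_cat S) id_ftr) = restrict_ftr (Free (p_graph S)) id_ftr"
      by (intro extensional_ftr_eqI[of "Free (p_graph S)"])
        (auto simp: extensional_ftr_restrict free_map_def Arr_Free)
    then show ?thesis by (simp add: CE_def)
  qed
  show "AMap (CE enc) (Comp Csys g f) = Comp rCEsys (AMap (CE enc) g) (AMap (CE enc) f)"
    if f: "f \<in> Hom Csys S T" and g: "g \<in> Hom Csys T U" for f g :: "('o, 'a) csys_arr" and S T U
  proof -
    from f obtain F where F: "f = (S, F, T)" "csys_hom S T F" by (auto simp: Hom_Csys)
    from g obtain G where G: "g = (T, G, U)" "csys_hom T U G" by (auto simp: Hom_Csys)
    interpret F: encoded_csys_hom S T F enc by (rule enc_hom[OF F(2)])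
    interpret G: encoded_csys_hom T U G enc by (rule enc_hom[OF G(2)])
    interpret GF: encoded_csys_hom S U "restrict_ftr (cs_cat S) (comp_ftr G F)" enc
      by (rule enc_hom[OF csys_hom_comp[OF F(2) G(2)]])
    have "map (OMap (restrict_ftr (cs_cat S) (comp_ftr G F))) es = map (OMap G) (map (OMap F) es)"
      if "path (p_graph S) X es Y" for X es Y
      using that by (induction es arbitrary: X) auto
    moreover have "X \<in> Obj (cs_cat S) \<and> Y \<in> Obj (cs_cat S)" if "path (p_graph S) X es Y" for X es Y
      using path_Obj[OF that] by simp
    ultimately have "free_map enc S (restrict_ftr (cs_cat S) (comp_ftr G F)) =
        restrict_ftr (Free (p_graph S)) (comp_ftr (free_map enc T G) (free_map enc S F))"
      using F.path_OMap F.OMap_in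
      by (intro extensional_ftr_eqI[of "Free (p_graph S)"])
        (auto simp: extensional_ftr_restrict free_map_def[of enc S "restrict_ftr _ _"] Arr_Free)
    then show ?thesis using F(1) G(1) by (simp add: CE_def)
  qed
qed


section \<open>The functor is full\<close>

text \<open>Fullness: the preimage of \<open>H\<close> is its second component, and the first
  component is then forced because its values on edges are.\<close>

lemma csys_hom_FC:
  fixes S T :: "('o, 'a) csys" and enc :: "'o \<times> 'o list \<times> 'o \<Rightarrow> 'f"
  assumes "encoded_c_system S enc" "encoded_c_system T enc"
    and str: "stratified_ce_hom (CE_obj enc S) (CE_obj enc T) H"
  shows "csys_hom S T (FC H)" and "FF H = free_map enc S (FC H)"
proof -
  interpret S: encoded_c_system S enc by fact
  interpret T: encoded_c_system T enc by fact
  interpret H: ce_hom "CE_obj enc S" "CE_obj enc T" H using str by (simp add: stratified_ce_hom_def)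
  have fC: "is_functor (cs_cat S) (cs_cat T) (FC H)" using H.C.is_functor_axioms by simp
  interpret F: is_functor "cs_cat S" "cs_cat T" "FC H" by (rule fC)
  have fF: "is_functor (S.Free S.P) (S.Free T.P) (FF H)" using H.F.is_functor_axioms by simp
  interpret G: is_functor "S.Free S.P" "S.Free T.P" "FF H" by (rule fF)
  have O: "OMap (FF H) X = OMap (FC H) X" if "X \<in> Obj (cs_cat S)" for X
    using H.I_Obj that by simp
  \<comment> \<open>The level functions in \<open>stratified_functor\<close> are unknown witnesses;
    uniqueness of stratifications replaces them by \<open>cs_len\<close>.\<close>
  have len: "cs_len T (OMap (FC H) X) = cs_len S X" if X: "X \<in> Obj (cs_cat S)" for X
  proof -
    from str obtain L M where "stratification (S.Free S.P) (cs_one S) L"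
      "stratification (S.Free T.P) (cs_one T) M" "L X = M (OMap (FF H) X)"
      using X by (auto simp: stratified_ce_hom_def stratified_functor_def)
    then show ?thesis using X O[OF X] F.OMap_in[OF X]
        stratification.level_unique[OF S.stratification_Free, of L X]
        stratification.level_unique[OF T.stratification_Free, of M "OMap (FC H) X"] by simp
  qed
  \<comment> \<open>The image of an edge lowers the level by one, so it is an edge itself; comparing
    its target gives preservation of \<open>cs_ft\<close>.\<close>
  have edge: "AMap (FF H) (S.edge \<Gamma>) = T.edge (OMap (FC H) \<Gamma>)"
      "OMap (FC H) (cs_ft S \<Gamma>) = cs_ft T (OMap (FC H) \<Gamma>)"
    if \<Gamma>: "\<Gamma> \<in> Obj (cs_cat S)" "cs_len S \<Gamma> > 0" for \<Gamma>
    using T.unit_arr_edge[of "AMap (FF H) (S.edge \<Gamma>)" "OMap (FC H) \<Gamma>" "OMap (FC H) (cs_ft S \<Gamma>)"]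
      G.AMap_in[OF S.edge_in[OF \<Gamma>]] \<Gamma> by (simp_all add: O S.ft_in len S.len_ft)
  \<comment> \<open>Preservation of \<open>cs_one\<close> and, next, of the canonical projections,
    the latter being the images under \<open>ce_I\<close> of one-edge paths.\<close>
  have one: "OMap (FC H) (cs_one S) = cs_one T" using H.pres_one O[OF S.one_in] by simp
  have p: "AMap (FC H) (cs_p S \<Gamma>) = cs_p T (OMap (FC H) \<Gamma>)"
    if \<Gamma>: "\<Gamma> \<in> Obj (cs_cat S)" "cs_len S \<Gamma> > 0" for \<Gamma>
  proof -
    have *: "composite (cs_cat S) \<Gamma> [cs_p S \<Gamma>] = cs_p S \<Gamma>"
      by (rule S.composite_single[OF S.p_in[OF \<Gamma>]])
    have **: "composite (cs_cat T) (OMap (FC H) \<Gamma>) [cs_p T (OMap (FC H) \<Gamma>)] = cs_p T (OMap (FC H) \<Gamma>)"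
      using \<Gamma> F.OMap_in len by (intro T.composite_single[OF T.p_in]) auto
    show ?thesis
      using H.I_Arr[of "S.edge \<Gamma>"] HomD(1)[OF S.edge_in[OF \<Gamma>]] edge(1)[OF \<Gamma>] * **
      unfolding S.CE_obj_simps by (simp add: S.edge_def T.edge_def del: composite.simps)
  qed
  have q: "AMap (FC H) (cs_q S f \<Gamma>) = cs_q T (AMap (FC H) f) (OMap (FC H) \<Gamma>)"
    and pb: "OMap (FC H) (cs_pb S f \<Gamma>) = cs_pb T (AMap (FC H) f) (OMap (FC H) \<Gamma>)"
    if \<Gamma>: "\<Gamma> \<in> Obj (cs_cat S)" "cs_len S \<Gamma> > 0" and f: "f \<in> Hom (cs_cat S) \<Delta> (cs_ft S \<Gamma>)"
    for \<Gamma> f \<Delta>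
  proof -
    \<comment> \<open>At a one-edge path the projection \<open>ce_pi2\<close> is
      \<open>cs_q\<close>, so preservation of \<open>cs_q\<close> is a special case.\<close>
    have "AMap (FC H) (ce_pi2 (CE_obj enc S) f (S.edge \<Gamma>)) =
        ce_pi2 (CE_obj enc T) (AMap (FC H) f) (AMap (FF H) (S.edge \<Gamma>))"
      using f Hom_slice[OF S.edge_in[OF \<Gamma>]] by (intro H.pres_pi2) auto
    then show *: "AMap (FC H) (cs_q S f \<Gamma>) = cs_q T (AMap (FC H) f) (OMap (FC H) \<Gamma>)"
      using edge(1)[OF \<Gamma>] by (simp add: S.edge_def T.edge_def)
    have f': "AMap (FC H) f \<in> Hom (cs_cat T) (OMap (FC H) \<Delta>) (cs_ft T (OMap (FC H) \<Gamma>))"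
      using F.AMap_in[OF f] edge(2)[OF \<Gamma>] by simp
    have \<Gamma>': "OMap (FC H) \<Gamma> \<in> Obj (cs_cat T)" "cs_len T (OMap (FC H) \<Gamma>) > 0"
      using \<Gamma> by (auto simp: len F.OMap_in)
    \<comment> \<open>The object is recovered as the common domain of the two sides of the equation
      for \<open>cs_q\<close>.\<close>
    show "OMap (FC H) (cs_pb S f \<Gamma>) = cs_pb T (AMap (FC H) f) (OMap (FC H) \<Gamma>)"
      using HomD(2)[OF F.AMap_in[OF S.q_in[OF \<Gamma> f]]] HomD(2)[OF T.q_in[OF \<Gamma>' f']] * by simp
  qed
  show hom: "csys_hom S T (FC H)"
  proof (intro csys_hom.intro csys_hom_axioms.intro S.c_system_axioms T.c_system_axioms fC one len)
    show "extensional_ftr (cs_cat S) (FC H)" using H.extensional_C by simp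
    \<comment> \<open>At length zero there is no edge to inspect; the object is
      \<open>cs_one S\<close>, which \<open>cs_ft\<close> fixes.\<close>
    show "OMap (FC H) (cs_ft S \<Gamma>) = cs_ft T (OMap (FC H) \<Gamma>)" if "\<Gamma> \<in> Obj (cs_cat S)" for \<Gamma>
      using edge(2)[OF that] S.len_zero[OF that] S.ft_one T.ft_one one
      by (cases "cs_len S \<Gamma> = 0") auto
  qed (use p q pb in auto)
  interpret E: encoded_csys_hom S T "FC H" enc
    using hom S.path_encoding_axioms by (simp add: encoded_csys_hom_def)
  show "FF H = free_map enc S (FC H)"
  proof (rule extensional_ftr_eqI[of "S.Free S.P"])
    show "extensional_ftr (S.Free S.P) (FF H)" using H.extensional_F by simp
    show "extensional_ftr (S.Free S.P) (free_map enc S (FC H))"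
      by (simp add: free_map_def extensional_ftr_restrict)
    show "OMap (FF H) X = OMap (free_map enc S (FC H)) X" if "X \<in> Obj (S.Free S.P)" for X
      using that by (simp add: O)
    fix a assume "a \<in> Arr (S.Free S.P)"
    then obtain X es Y where a: "a = enc (X, es, Y)" "path S.P X es Y" by (auto simp: S.Arr_Free)
    \<comment> \<open>Agreement on edges suffices, since every arrow of the free category is a
      composite of edges.\<close>
    have "\<forall>\<Gamma>\<in>set es. AMap (FF H) (S.edge \<Gamma>) = T.edge (OMap (FC H) \<Gamma>)"
      using a(2)
    proof (induction es arbitrary: X)
      case (Cons \<Xi> es)
      then show ?case using edge(1)[of \<Xi>] by auto
    qed simp
    then have "map (AMap (FF H)) (map S.edge es) = map T.edge (map (OMap (FC H)) es)" by simp
    then show "AMap (FF H) a = AMap (free_map enc S (FC H)) a"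
      using S.edge_factorization[OF a(2)] T.edge_factorization[OF E.path_OMap[OF a(2)]]
        G.AMap_composite[of X "map S.edge es" Y] a O[OF path_Obj(1)[OF a(2), simplified]] by (simp del: map_map)
  qed
qed


section \<open>The functor is essentially surjective\<close>

text \<open>A witness \<open>L\<close> of \<open>stratified_ce\<close> is fixed here, so that the
  unit arrows \<open>F.proj\<close> become available as operations.\<close>

locale stratified_rooted_ce_system =
  rooted_ce_system T + F: stratification "ce_F T" "ce_one T" L
  for T :: "('o, 'f, 'a) cesys" and L +
  assumes level_pb: "f \<in> Hom (ce_C T) \<Delta> \<Gamma> \<Longrightarrow> A \<in> slice (ce_F T) \<Gamma> \<Longrightarrow>
    slice_level (ce_F T) L A = slice_level (ce_F T) L (ce_pb T f A)"
begin

sublocale C: category "ce_C T" by (rule category_C)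

text \<open>At level zero no unit arrow exists, so \<open>cs_ft\<close> gets the default
  \<open>ce_one T\<close> there, as the axiom \<open>ft_one\<close> requires. Keeping only the
  domain of a pulled-back projection in \<open>cs_pb\<close> loses nothing, by
  \<open>pb_proj\<close>.\<close>

definition csys_of :: "('o, 'a) csys" where
  "csys_of = \<lparr>cs_cat = ce_C T, cs_len = L, cs_one = ce_one T,
    cs_ft = (\<lambda>X. if L X = 0 then ce_one T else Cod (ce_F T) (F.proj X)),
    cs_p = (\<lambda>X. ce_I T (F.proj X)),
    cs_pb = (\<lambda>f X. Dom (ce_F T) (ce_pb T f (F.proj X))),
    cs_q = (\<lambda>f X. ce_pi2 T f (F.proj X))\<rparr>"

abbreviation "ft X \<equiv> cs_ft csys_of X"

lemma csys_of_simps [simp]: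
  "cs_cat csys_of = ce_C T" "cs_len csys_of = L" "cs_one csys_of = ce_one T"
  "cs_p csys_of X = ce_I T (F.proj X)"
  "cs_pb csys_of f X = Dom (ce_F T) (ce_pb T f (F.proj X))"
  "cs_q csys_of f X = ce_pi2 T f (F.proj X)"
  by (auto simp: csys_of_def)

lemma proj_in: "X \<in> Obj (ce_C T) \<Longrightarrow> L X > 0 \<Longrightarrow> F.proj X \<in> Hom (ce_F T) X (ft X)"
  using F.proj_in[of X] by (simp add: Obj_eq csys_of_def)

lemma level_ft: "X \<in> Obj (ce_C T) \<Longrightarrow> L X > 0 \<Longrightarrow> L X = Suc (L (ft X))"
  using F.level_Cod_proj[of X] by (simp add: Obj_eq csys_of_def)

lemma proj_eqI: "g \<in> Hom (ce_F T) X Y \<Longrightarrow> L X = Suc (L Y) \<Longrightarrow> F.proj X = g \<and> ft X = Y"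
  using F.proj_eqI[of g X Y] by (simp add: csys_of_def HomD)

text \<open>The pullback functor preserves slice levels, so the pullback of a unit arrow is a unit
  arrow over \<Delta>, and thus the only one out of its domain.\<close>

lemma pb_proj:
  assumes X: "X \<in> Obj (ce_C T)" "L X > 0" and f: "f \<in> Hom (ce_C T) \<Delta> (ft X)"
  defines "W \<equiv> Dom (ce_F T) (ce_pb T f (F.proj X))"
  shows "W \<in> Obj (ce_C T)" "L W > 0" "ft W = \<Delta>" "ce_pb T f (F.proj X) = F.proj W"
    "ce_pi2 T f (F.proj X) \<in> Hom (ce_C T) W X"
proof -
  note A = Hom_slice[OF proj_in[OF X]]
  have pb: "ce_pb T f (F.proj X) \<in> Hom (ce_F T) W \<Delta>"
    using pb_in[OF f A] by (simp add: W_def slice_iff)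
  \<comment> \<open>The subtraction is truncated, but the value one rules truncation out.\<close>
  have "L W - L \<Delta> = 1"
    using level_pb[OF f A] proj_in[OF X] level_ft[OF X] pb by (simp add: slice_level_def HomD)
  then have LW: "L W = Suc (L \<Delta>)" by simp
  show "W \<in> Obj (ce_C T)" using F.Hom_Obj[OF pb] Obj_eq by simp
  show "L W > 0" using LW by simp
  show "ft W = \<Delta>" "ce_pb T f (F.proj X) = F.proj W" using proj_eqI[OF pb LW] by auto
  show "ce_pi2 T f (F.proj X) \<in> Hom (ce_C T) W X"
    using pi2_in[OF f A] proj_in[OF X] by (simp add: W_def HomD)
qed

lemma c_system_csys_of: "c_system csys_of"
proof (intro c_system.intro c_system_axioms.intro)
  show "category (cs_cat csys_of)" by (simp add: C.category_axioms)
  show "cs_one csys_of \<in> Obj (cs_cat csys_of)" using rooted by (simp add: terminal_def)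
  show "terminal (cs_cat csys_of) (cs_one csys_of)" using rooted by simp
  show "ft (cs_one csys_of) = cs_one csys_of" using F.level_terminal by (simp add: csys_of_def)
  show "ft X \<in> Obj (cs_cat csys_of)" if "X \<in> Obj (cs_cat csys_of)" for X
    using that F.Hom_Obj(2)[OF proj_in[of X]] rooted Obj_eq
    by (cases "L X = 0") (auto simp: terminal_def csys_of_def)
  show "cs_len csys_of X = 0 \<longleftrightarrow> X = cs_one csys_of" if "X \<in> Obj (cs_cat csys_of)" for X
    using that F.zero_iff[of X] by (simp add: Obj_eq)
  fix X assume "X \<in> Obj (cs_cat csys_of)" "cs_len csys_of X > 0"
  then have X: "X \<in> Obj (ce_C T)" "L X > 0" by auto
  note p = proj_in[OF X]
  have ftX: "ft X \<in> Obj (ce_C T)" using F.Hom_Obj(2)[OF p] Obj_eq by simp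
  show "cs_p csys_of X \<in> Hom (cs_cat csys_of) X (ft X)" using I_in[OF p] by simp
  show "cs_len csys_of (ft X) = cs_len csys_of X - 1" using level_ft[OF X] by simp
  show "cs_pb csys_of (Idt (cs_cat csys_of) (ft X)) X = X"
    and "cs_q csys_of (Idt (cs_cat csys_of) (ft X)) X = Idt (cs_cat csys_of) X"
    using pb_along_Idt[OF ftX Hom_slice[OF p]] pi2_along_Idt[OF ftX Hom_slice[OF p]] p
    by (auto simp: HomD)
  fix f \<Delta> assume "f \<in> Hom (cs_cat csys_of) \<Delta> (ft X)"
  then have f: "f \<in> Hom (ce_C T) \<Delta> (ft X)" by simp
  note P = pb_proj[OF X f]
  show "cs_pb csys_of f X \<in> Obj (cs_cat csys_of)" "cs_len csys_of (cs_pb csys_of f X) > 0"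
    "ft (cs_pb csys_of f X) = \<Delta>" "cs_q csys_of f X \<in> Hom (cs_cat csys_of) (cs_pb csys_of f X) X"
    using P by auto
  show "pullback (cs_cat csys_of) (cs_p csys_of X) f (cs_q csys_of f X)
      (cs_p csys_of (cs_pb csys_of f X))"
    using pb_pullback[OF f Hom_slice[OF p]] P(4) by simp
  fix g E assume "g \<in> Hom (cs_cat csys_of) E \<Delta>"
  then have g: "g \<in> Hom (ce_C T) E \<Delta>" by simp
  \<comment> \<open>\<open>P(4)\<close> rewrites the pulled-back projection as the projection of its
    domain, so that pulling back twice in \<open>T\<close> is what iterating \<open>cs_pb\<close>
    computes.\<close>
  show "cs_pb csys_of (Comp (cs_cat csys_of) f g) X = cs_pb csys_of g (cs_pb csys_of f X)"
    using pb_along_Comp[OF f g Hom_slice[OF p]] P(4) by simp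
  show "cs_q csys_of (Comp (cs_cat csys_of) f g) X =
      Comp (cs_cat csys_of) (cs_q csys_of f X) (cs_q csys_of g (cs_pb csys_of f X))"
    using pi2_along_Comp[OF f g Hom_slice[OF p]] P(4) by simp
qed

sublocale K: c_system csys_of by (rule c_system_csys_of)

section \<open>Paths of unit arrows and their composites\<close>

lemma path_proj:
  "path K.P X es Y \<Longrightarrow> path (ce_F T) X (map F.proj es) Y \<and> unit_steps (ce_F T) L (map F.proj es)"
proof (induction es arbitrary: X)
  case (Cons \<Xi> es)
  then show ?case using HomD[OF proj_in[of \<Xi>]] level_ft[of \<Xi>] by (auto simp: Obj_eq)
qed (simp add: Obj_eq)

lemma unit_steps_path:
  "path (ce_F T) X gs Y \<Longrightarrow> unit_steps (ce_F T) L gs \<Longrightarrow> \<exists>es. path K.P X es Y \<and> gs = map F.proj es"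
proof (induction gs arbitrary: X)
  case Nil
  then show ?case by (intro exI[of _ "[]"]) (auto simp: Obj_eq)
next
  case (Cons g gs)
  then have g: "F.proj X = g \<and> ft X = Cod (ce_F T) g"
    by (intro proj_eqI HomI) auto
  from Cons obtain es where "path K.P (Cod (ce_F T) g) es Y" "gs = map F.proj es" by auto
  then show ?case using g Cons.prems by (intro exI[of _ "X # es"]) (auto simp: Obj_eq)
qed

definition path_arr :: "'o \<Rightarrow> 'o list \<Rightarrow> 'f" where
  "path_arr X es = composite (ce_F T) X (map F.proj es)"

lemma path_arr_in: "path K.P X es Y \<Longrightarrow> path_arr X es \<in> Hom (ce_F T) X Y"
  using path_proj by (simp add: path_arr_def F.composite_in)

lemma path_arr_Cons:
  "path K.P X (\<Xi> # es) Y \<Longrightarrow> path_arr X (\<Xi> # es) = Comp (ce_F T) (path_arr (ft \<Xi>) es) (F.proj \<Xi>)"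
  using HomD[OF proj_in[of \<Xi>]] by (auto simp: path_arr_def)

lemma path_arr_append:
  "path K.P X es Y \<Longrightarrow> path K.P Y es' Z \<Longrightarrow>
    path_arr X (es @ es') = Comp (ce_F T) (path_arr Y es') (path_arr X es)"
  by (simp add: path_arr_def F.composite_append[OF conjunct1[OF path_proj] conjunct1[OF path_proj]])

lemma I_path_arr:
  assumes "path K.P X es Y"
  shows "ce_I T (path_arr X es) = composite (ce_C T) X (map (cs_p csys_of) es)"
proof -
  have "cs_p csys_of = (\<lambda>X. ce_I T (F.proj X))" by (simp add: fun_eq_iff)
  then show ?thesis
    using is_functor.AMap_composite[OF I_functor path_proj[OF assms, THEN conjunct1]]
    by (simp add: path_arr_def ce_I_ftr_def comp_def)
qed

text \<open>The unit factorization of \<open>A\<close> consists of projections, so it is named by a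
  path in the graph of \<open>csys_of\<close>.\<close>

lemma path_arr_surj:
  assumes "A \<in> Hom (ce_F T) X Y"
  shows "\<exists>es. path K.P X es Y \<and> A = path_arr X es"
proof -
  from F.unit_factorization[OF assms] obtain gs
    where "path (ce_F T) X gs Y" "composite (ce_F T) X gs = A" "unit_steps (ce_F T) L gs" by blast
  with unit_steps_path show ?thesis unfolding path_arr_def by metis
qed

text \<open>Axioms (a) and (d) make the given pullbacks obey the recursion of
  \<open>pb_path\<close>, so they are determined by their values on projections.\<close>

lemma pb_path_arr:
  assumes "path K.P X es \<Gamma>" and f: "f \<in> Hom (ce_C T) \<Delta> \<Gamma>"
  shows "ce_pb T f (path_arr X es) =
      path_arr (Dom (ce_C T) (snd (pb_path csys_of f es))) (fst (pb_path csys_of f es)) \<and>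
    ce_pi2 T f (path_arr X es) = snd (pb_path csys_of f es)"
  using assms(1)
proof (induction es arbitrary: X)
  case Nil
  then show ?case using pb_of_Idt[OF f] pi2_of_Idt[OF f] f by (auto simp: path_arr_def HomD)
next
  case (Cons \<Xi> es)
  let ?P = "pb_path csys_of f es"
  from Cons.prems have \<Xi>: "X = \<Xi>" "\<Xi> \<in> Obj (ce_C T)" "L \<Xi> > 0" and es: "path K.P (ft \<Xi>) es \<Gamma>"
    by auto
  have f': "f \<in> Hom (cs_cat csys_of) \<Delta> \<Gamma>" using f by simp
  from K.pb_path_in[OF es f'] obtain W where W: "path K.P W (fst ?P) \<Delta>"
    and g: "snd ?P \<in> Hom (ce_C T) W (ft \<Xi>)" by auto
  from K.pb_path_in[OF Cons.prems f'] obtain V where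
    V: "path K.P V (fst (pb_path csys_of f (\<Xi> # es))) \<Delta>"
    and h: "snd (pb_path csys_of f (\<Xi> # es)) \<in> Hom (ce_C T) V \<Xi>" using \<Xi>(1) by auto
  let ?V = "Dom (ce_F T) (ce_pb T (snd ?P) (F.proj \<Xi>))"
  have VV: "V = ?V" using V by simp
  note A = Hom_slice[OF path_arr_in[OF es]]
  have Q: "F.proj \<Xi> \<in> slice (ce_F T) (Dom (ce_F T) (path_arr (ft \<Xi>) es))"
    using Hom_slice[OF proj_in[OF \<Xi>(2,3)]] path_arr_in[OF es] by (simp add: HomD)
  \<comment> \<open>The pullback of the projection of \<Xi> along \<open>snd ?P\<close> is again a
    projection, namely that of \<open>?V\<close>, which heads the new path.\<close>
  note Pp = pb_proj[OF \<Xi>(2,3) g]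
  have "path_arr V (fst (pb_path csys_of f (\<Xi> # es))) =
      Comp (ce_F T) (path_arr W (fst ?P)) (F.proj ?V)"
    using path_arr_Cons[of V ?V "fst ?P" \<Delta>] V Pp(3) by auto
  then show ?case
    using Cons.IH[OF es] pb_of_Comp[OF f A Q] pi2_of_Comp[OF f A Q] path_arr_Cons[OF Cons.prems]
      Pp(4) HomD(2)[OF g] HomD(2)[OF h] by simp
qed

end

text \<open>With the second component an identity, \<open>H\<close> also fixes all objects, and the
  inverse of its bijection on arrows inherits every preservation property from
  \<open>H\<close>.\<close>

lemma iso_arr_rCEsysI:
  fixes S T :: "('o, 'f, 'a) cesys"
  assumes ST: "S \<in> Obj rCEsys" "T \<in> Obj rCEsys" and H: "stratified_ce_hom S T H"
    and C_eq: "ce_C S = ce_C T" and FC_H: "FC H = restrict_ftr (ce_C S) id_ftr"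
    and bij: "bij_betw (AMap (FF H)) (Arr (ce_F S)) (Arr (ce_F T))"
  shows "iso_arr rCEsys (S, H, T)"
proof -
  interpret H: ce_hom S T H using H by (simp add: stratified_ce_hom_def)
  define V where "V = inv_into (Arr (ce_F S)) (AMap (FF H))"
  let ?K = "\<lparr>FF = restrict_ftr (ce_F T) \<lparr>OMap = (\<lambda>X. X), AMap = V\<rparr>,
    FC = restrict_ftr (ce_C T) id_ftr\<rparr>"
  have Obj_eq: "Obj (ce_F S) = Obj (ce_C T)" "Obj (ce_F T) = Obj (ce_C T)"
    using H.src.Obj_eq H.tgt.Obj_eq C_eq by simp_all
  have OF: "OMap (FF H) X = X" if "X \<in> Obj (ce_C T)" for X
    using H.I_Obj[of X] that by (simp add: Obj_eq FC_H C_eq)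
  have V: "V B \<in> Arr (ce_F S)" "AMap (FF H) (V B) = B" if "B \<in> Arr (ce_F T)" for B
    using that bij unfolding V_def bij_betw_def by (auto intro: inv_into_into f_inv_into_f)
  have V_left: "V (AMap (FF H) A) = A" if "A \<in> Arr (ce_F S)" for A
    using that bij by (simp add: V_def bij_betw_def)
  \<comment> \<open>The laws for \<open>V\<close> at identities, composites and chosen pullbacks
    reduce through this to the corresponding laws for \<open>H\<close>.\<close>
  have V_eqI: "V B = A" if "A \<in> Arr (ce_F S)" "AMap (FF H) A = B" for A B
    using V_left that by auto
  have V_Hom: "V B \<in> Hom (ce_F S) X Y" if B: "B \<in> Hom (ce_F T) X Y" for B X Y
    using V[OF HomD(1)[OF B]] H.F.AMap_Arr[of "V B"] HomD[OF B] H.F.src.Dom_in[of "V B"]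
      H.F.src.Cod_in[of "V B"] OF by (intro HomI) (auto simp: Obj_eq)
  have V_slice: "V A \<in> slice (ce_F S) \<Gamma>" if "A \<in> slice (ce_F T) \<Gamma>" for A \<Gamma>
    using Hom_slice[OF V_Hom] that by (simp add: slice_iff[of A])
  have fV: "is_functor (ce_F T) (ce_F S) \<lparr>OMap = (\<lambda>X. X), AMap = V\<rparr>"
  proof (rule is_functorI[OF H.tgt.category_F H.src.category_F])
    fix X assume X: "X \<in> Obj (ce_F T)"
    then have "V (Idt (ce_F T) X) = Idt (ce_F S) X"
      using HomD(1)[OF H.F.src.Idt_in[of X]] H.F.AMap_Idt[of X]
      by (intro V_eqI) (auto simp: Obj_eq OF)
    then show "AMap \<lparr>OMap = (\<lambda>X. X), AMap = V\<rparr> (Idt (ce_F T) X) =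
        Idt (ce_F S) (OMap \<lparr>OMap = (\<lambda>X. X), AMap = V\<rparr> X)" by simp
  next
    fix f g X Y Z assume f: "f \<in> Hom (ce_F T) X Y" and g: "g \<in> Hom (ce_F T) Y Z"
    have "V (Comp (ce_F T) g f) = Comp (ce_F S) (V g) (V f)"
      using HomD(1)[OF H.F.src.Comp_in[OF V_Hom[OF f] V_Hom[OF g]]]
        H.F.AMap_Comp[OF V_Hom[OF f] V_Hom[OF g]] V(2) HomD(1)[OF f] HomD(1)[OF g]
      by (intro V_eqI) auto
    then show "AMap \<lparr>OMap = (\<lambda>X. X), AMap = V\<rparr> (Comp (ce_F T) g f) =
        Comp (ce_F S) (AMap \<lparr>OMap = (\<lambda>X. X), AMap = V\<rparr> g) (AMap \<lparr>OMap = (\<lambda>X. X), AMap = V\<rparr> f)"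
      by simp
  qed (auto simp: Obj_eq V_Hom)
  have "ce_hom T S ?K"
  proof (intro ce_hom.intro ce_hom_axioms.intro H.src.ce_system_axioms H.tgt.ce_system_axioms)
    show "is_functor (ce_F T) (ce_F S) (FF ?K)" using is_functor_restrict[OF fV] by simp
    show "is_functor (ce_C T) (ce_C S) (FC ?K)"
      using is_functor_restrict[OF is_functor_id[OF H.tgt.category_C]] by (simp add: C_eq)
    show "OMap (FF ?K) (ce_one T) = ce_one S"
      using H.src.one_terminal H.tgt.one_terminal H.pres_one
      by (simp add: terminal_def OF Obj_eq)
    show "AMap (FC ?K) (ce_I T B) = ce_I S (AMap (FF ?K) B)" if B: "B \<in> Arr (ce_F T)" for B
      using H.I_Arr[OF V(1)[OF B]] V[OF B] H.tgt.I_Arr_in[OF B] H.src.I_Arr_in[OF V(1)[OF B]] B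
      by (simp add: FC_H C_eq)
    fix f \<Delta> \<Gamma> A assume f: "f \<in> Hom (ce_C T) \<Delta> \<Gamma>" and A: "A \<in> slice (ce_F T) \<Gamma>"
    have f': "f \<in> Hom (ce_C S) \<Delta> \<Gamma>" using f C_eq by simp
    note V(2)[of A] H.src.pb_in[OF f' V_slice[OF A]] H.tgt.pb_in[OF f A]
      HomD(1)[OF H.src.pi2_in[OF f' V_slice[OF A]]] HomD(1)[OF H.tgt.pi2_in[OF f A]]
      H.pres_pb[OF f' V_slice[OF A]] H.pres_pi2[OF f' V_slice[OF A]] HomD(1)[OF f] A
    note * = this
    show "AMap (FF ?K) (ce_pb T f A) = ce_pb S (AMap (FC ?K) f) (AMap (FF ?K) A)"
      using * V_eqI[of "ce_pb S f (V A)" "ce_pb T f A"] by (simp add: FC_H C_eq slice_def)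
    show "AMap (FC ?K) (ce_pi2 T f A) = ce_pi2 S (AMap (FC ?K) f) (AMap (FF ?K) A)"
      using * by (simp add: FC_H C_eq slice_def)
  qed (auto simp: extensional_ftr_restrict Obj_eq)
  moreover have "stratified_functor (ce_F T) (ce_one T) (ce_F S) (ce_one S) (FF ?K)"
  proof -
    \<comment> \<open>The level functions for \<open>H\<close> serve the inverse in the opposite
      order, because \<open>H\<close> fixes objects.\<close>
    from H obtain L M where "stratification (ce_F S) (ce_one S) L" "stratification (ce_F T) (ce_one T) M"
      "\<And>X. X \<in> Obj (ce_F S) \<Longrightarrow> L X = M (OMap (FF H) X)"
      unfolding stratified_ce_hom_def stratified_functor_def by blast
    moreover have "is_functor (ce_F T) (ce_F S) (FF ?K)" using is_functor_restrict[OF fV] by simp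
    ultimately show ?thesis unfolding stratified_functor_def
      by (intro conjI exI[of _ M] exI[of _ L]) (auto simp: Obj_eq OF)
  qed
  ultimately have K: "(T, ?K, S) \<in> Hom rCEsys T S"
    using ST by (simp add: Hom_rCEsys stratified_ce_hom_def)
  have "Comp rCEsys (T, ?K, S) (S, H, T) = Idt rCEsys S"
    using H.F.OMap_in H.F.AMap_Arr(1)
    by (auto simp: FC_H C_eq V_left OF Obj_eq intro!: extensional_ftr_eqI extensional_ftr_restrict)
  moreover have "Comp rCEsys (S, H, T) (T, ?K, S) = Idt rCEsys T"
    by (auto simp: FC_H C_eq V OF Obj_eq intro!: extensional_ftr_eqI extensional_ftr_restrict)
  moreover have "(S, H, T) \<in> Hom rCEsys S T" using ST H by (simp add: Hom_rCEsys)
  ultimately show ?thesis using category.iso_arrI[OF category_rCEsys _ K] by blast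
qed

section \<open>The comparison from the rebuilt CE-system to the given one\<close>

locale encoded_ce_system = stratified_rooted_ce_system T L + path_encoding enc
  for T :: "('o, 'f, 'a) cesys" and L and enc :: "'o \<times> 'o list \<times> 'o \<Rightarrow> 'f"
begin

sublocale K: encoded_c_system csys_of enc ..

text \<open>Evaluation needs only the source and the edges, the target being implied. Both
  components are restricted because CE-homomorphisms are extensional.\<close>

definition counit :: "('o, 'f, 'a, 'o, 'f, 'a) ceftr" where
  "counit = \<lparr>FF = restrict_ftr (Free K.P)
      \<lparr>OMap = (\<lambda>X. X), AMap = (\<lambda>a. case inv enc a of (X, es, Y) \<Rightarrow> path_arr X es)\<rparr>,
    FC = restrict_ftr (ce_C T) id_ftr\<rparr>"

lemma counit_simps [simp]:
  "FC counit = restrict_ftr (ce_C T) id_ftr"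
  "X \<in> Obj (ce_C T) \<Longrightarrow> OMap (FF counit) X = X"
  "path K.P X es Y \<Longrightarrow> AMap (FF counit) (enc (X, es, Y)) = path_arr X es"
  by (auto simp: counit_def Arr_Free)

lemma is_functor_counit: "is_functor (Free K.P) (ce_F T) (FF counit)"
proof (rule is_functorI[OF category_Free category_F])
  fix f X Y assume "f \<in> Hom (Free K.P) X Y"
  then show "AMap (FF counit) f \<in> Hom (ce_F T) (OMap (FF counit) X) (OMap (FF counit) Y)"
    using path_Obj[of K.P X _ Y] by (auto simp: Hom_Free path_arr_in)
next
  fix f g X Y Z assume "f \<in> Hom (Free K.P) X Y" "g \<in> Hom (Free K.P) Y Z"
  then obtain es es' where "f = enc (X, es, Y)" "g = enc (Y, es', Z)"
    and *: "path K.P X es Y" "path K.P Y es' Z" by (auto simp: Hom_Free)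
  moreover from * have "path K.P X (es @ es') Z" by (auto simp: path_append)
  ultimately show "AMap (FF counit) (Comp (Free K.P) g f) =
      Comp (ce_F T) (AMap (FF counit) g) (AMap (FF counit) f)" by (simp add: path_arr_append)
qed (auto simp: Obj_eq path_arr_def)

lemma stratified_ce_hom_counit: "stratified_ce_hom (CE_obj enc csys_of) T counit"
proof -
  have "ce_hom (CE_obj enc csys_of) T counit"
  proof (intro ce_hom.intro ce_hom_axioms.intro ce_system_axioms)
    show "ce_system (CE_obj enc csys_of)"
      using K.rooted_ce_system_CE_obj by (simp add: rooted_ce_system_def)
    show "is_functor (ce_F (CE_obj enc csys_of)) (ce_F T) (FF counit)"
      by (simp add: is_functor_counit)
    show "is_functor (ce_C (CE_obj enc csys_of)) (ce_C T) (FC counit)"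
      by (simp add: is_functor_restrict is_functor_id category_C)
    show "extensional_ftr (ce_F (CE_obj enc csys_of)) (FF counit)"
      by (simp add: counit_def extensional_ftr_restrict)
    show "OMap (FF counit) (ce_one (CE_obj enc csys_of)) = ce_one T"
      using rooted by (simp add: terminal_def)
    show "AMap (FC counit) (ce_I (CE_obj enc csys_of) A) = ce_I T (AMap (FF counit) A)"
      if "A \<in> Arr (ce_F (CE_obj enc csys_of))" for A
    proof -
      from that obtain X es Y where A: "A = enc (X, es, Y)" "path K.P X es Y"
        by (auto simp: Arr_Free)
      then show ?thesis
        using I_path_arr[OF A(2)] I_Arr_in[OF HomD(1)[OF path_arr_in[OF A(2)]]] by simp
    qed
    fix f \<Delta> \<Gamma> A
    assume "f \<in> Hom (ce_C (CE_obj enc csys_of)) \<Delta> \<Gamma>" "A \<in> slice (ce_F (CE_obj enc csys_of)) \<Gamma>"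
    then obtain X es where f: "f \<in> Hom (ce_C T) \<Delta> \<Gamma>" and A: "A = enc (X, es, \<Gamma>)" "path K.P X es \<Gamma>"
      by (auto simp: slice_Free)
    from K.pb_path_in[OF A(2)] f obtain W where W: "path K.P W (fst (pb_path csys_of f es)) \<Delta>"
      and h: "snd (pb_path csys_of f es) \<in> Hom (ce_C T) W X" by fastforce
    show "AMap (FF counit) (ce_pb (CE_obj enc csys_of) f A) =
        ce_pb T (AMap (FC counit) f) (AMap (FF counit) A)"
      using A W HomD[OF f] HomD(2)[OF h] pb_path_arr[OF A(2) f] by simp
    show "AMap (FC counit) (ce_pi2 (CE_obj enc csys_of) f A) =
        ce_pi2 T (AMap (FC counit) f) (AMap (FF counit) A)"
      using A HomD(1)[OF f] HomD(1)[OF h] pb_path_arr[OF A(2) f] by simp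
  qed (auto simp: extensional_ftr_restrict)
  moreover have "stratified_functor (Free K.P) (ce_one T) (ce_F T) (ce_one T) (FF counit)"
    unfolding stratified_functor_def
    using is_functor_counit K.stratification_Free F.stratification_axioms
    by (intro conjI exI[of _ L]) auto
  ultimately show ?thesis by (simp add: stratified_ce_hom_def)
qed

text \<open>Injectivity needs no cancellation: the composite remembers its endpoints, and these
  determine the path. Surjectivity is the existence of unit factorizations.\<close>

lemma bij_counit: "bij_betw (AMap (FF counit)) (Arr (Free K.P)) (Arr (ce_F T))"
proof (rule bij_betw_imageI)
  show "inj_on (AMap (FF counit)) (Arr (Free K.P))"
  proof (rule inj_onI)
    fix a b assume "a \<in> Arr (Free K.P)" "b \<in> Arr (Free K.P)" and e: "AMap (FF counit) a = AMap (FF counit) b"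
    then obtain X es Y X' es' Y' where a: "a = enc (X, es, Y)" "path K.P X es Y"
      and b: "b = enc (X', es', Y')" "path K.P X' es' Y'" by (auto simp: Arr_Free)
    have "X = X'" "Y = Y'" using e a b path_arr_in[OF a(2)] path_arr_in[OF b(2)] by (auto simp: Hom_def)
    then show "a = b" using a b K.path_unique by auto
  qed
  show "AMap (FF counit) ` Arr (Free K.P) = Arr (ce_F T)"
  proof (intro equalityI subsetI)
    fix A assume "A \<in> Arr (ce_F T)"
    from path_arr_surj[OF Arr_Hom[OF this]] obtain X es Y where "path K.P X es Y" "A = path_arr X es"
      by blast
    then show "A \<in> AMap (FF counit) ` Arr (Free K.P)"
      by (intro image_eqI[of _ _ "enc (X, es, Y)"]) (auto simp: Arr_Free)
  qed (auto simp: is_functor.AMap_Arr[OF is_functor_counit])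
qed

lemma CE_ess_surj:
  assumes "stratified_ce T"
  shows "(CE_obj enc csys_of, counit, T) \<in> Hom rCEsys (CE_obj enc csys_of) T"
    "iso_arr rCEsys (CE_obj enc csys_of, counit, T)"
proof -
  have ST: "CE_obj enc csys_of \<in> Obj rCEsys" "T \<in> Obj rCEsys"
    using K.rooted_ce_system_CE_obj K.stratified_ce_CE_obj rooted_ce_system_axioms assms by simp_all
  show "(CE_obj enc csys_of, counit, T) \<in> Hom rCEsys (CE_obj enc csys_of) T"
    using ST stratified_ce_hom_counit by (simp add: Hom_rCEsys)
  show "iso_arr rCEsys (CE_obj enc csys_of, counit, T)"
    using bij_counit by (intro iso_arr_rCEsysI[OF ST stratified_ce_hom_counit]) simp_all
qed

end

theorem theorem3p31:
  fixes enc :: "'o \<times> 'o list \<times> 'o \<Rightarrow> 'f"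
  assumes "inj enc"
  shows "equivalence_of_categories
           (Csys :: (('o, 'a) csys, ('o, 'a) csys_arr) cat)
           (rCEsys :: (('o, 'f, 'a) cesys, ('o, 'f, 'a) ce_arr) cat)
           (CE enc)"
proof (rule is_functor.equivalenceI[OF is_functor_CE[OF assms]])
  have enc: "path_encoding enc" using assms by unfold_locales
  show "f = g" if "f \<in> Hom Csys S T" "g \<in> Hom Csys S T" "AMap (CE enc) f = AMap (CE enc) g"
    for f g :: "('o, 'a) csys_arr" and S T
    using that by (auto simp: Hom_Csys CE_def)
  show "\<exists>f \<in> Hom Csys S T. AMap (CE enc) f = h"
    if "S \<in> Obj Csys" "T \<in> Obj Csys" and h: "h \<in> Hom rCEsys (OMap (CE enc) S) (OMap (CE enc) T)"
    for S T :: "('o, 'a) csys" and h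
  proof -
    from h obtain H where H: "h = (CE_obj enc S, H, CE_obj enc T)"
      "stratified_ce_hom (CE_obj enc S) (CE_obj enc T) H" by (auto simp: Hom_rCEsys CE_def)
    have "encoded_c_system S enc" "encoded_c_system T enc"
      using that enc by (auto simp: encoded_c_system_def)
    note * = csys_hom_FC[OF this H(2)]
    then show ?thesis using H(1) by (intro bexI[of _ "(S, FC H, T)"]) (auto simp: CE_def Hom_Csys)
  qed
  show "\<exists>S \<in> Obj Csys. \<exists>e \<in> Hom rCEsys (OMap (CE enc) S) T. iso_arr rCEsys e"
    if T: "T \<in> Obj rCEsys" for T :: "('o, 'f, 'a) cesys"
  proof -
    from T obtain L where L: "rooted_ce_system T" "stratification (ce_F T) (ce_one T) L"
      "\<And>\<Delta> \<Gamma> f A. f \<in> Hom (ce_C T) \<Delta> \<Gamma> \<Longrightarrow> A \<in> slice (ce_F T) \<Gamma> \<Longrightarrow>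
        slice_level (ce_F T) L A = slice_level (ce_F T) L (ce_pb T f A)"
      by (auto simp: stratified_ce_def)
    interpret encoded_ce_system T L enc
      using L enc by (simp add: encoded_ce_system_def stratified_rooted_ce_system_def
          stratified_rooted_ce_system_axioms_def)
    from T have "stratified_ce T" by simp
    from CE_ess_surj[OF this] c_system_csys_of show ?thesis
      by (intro bexI[of _ csys_of]) (auto simp: CE_def)
  qed
qed

end
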